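(* Let $m\ge2$. If $1\le p\le 2$, then $\mathfrak{F}^{\mathrm{convex}}_p\le\big(\mathfrak{F}^{\mathrm{convex}}_1\big)^{1/p}$.
   Context: For a non-empty open $\Omega\subset\mathbb{R}^m$ with $|\Omega|<\infty$, $\lambda_1(\Omega)=\inf_{\varphi\in H_0^1(\Omega)\setminus\{0\}}\int_\Omega|D\varphi|^2/\int_\Omega\varphi^2$, $v_\Omega$ is the unique solution of $-\Delta v=1$, $v\in H_0^1(\Omega)$, $F_p(\Omega)=\|v_\Omega\|_{L^p(\Omega)}\lambda_1(\Omega)/|\Omega|^{1/p}$, and $\mathfrak{F}^{\mathrm{convex}}_p=\sup\{F_p(\Omega):\Omega\text{ open, convex in }\mathbb{R}^m,\ 0<|\Omega|<\infty\}$. *)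

theory Defs
  imports "HOL-Analysis.Analysis"
begin

text \<open>Test functions: C^1 functions with compact support inside Omega, together with
  their (continuous) gradient.  The closure of these in H^1 is H_0^1(Omega).\<close>
definition test_fun :: "'a::euclidean_space set \<Rightarrow> ('a \<Rightarrow> real) \<Rightarrow> ('a \<Rightarrow> 'a) \<Rightarrow> bool" where
  "test_fun \<Omega> \<phi> g \<longleftrightarrow>
     continuous_on UNIV g \<and>
     (\<forall>x. (\<phi> has_derivative (\<lambda>h. g x \<bullet> h)) (at x)) \<and>
     (\<exists>K. compact K \<and> K \<subseteq> \<Omega> \<and> (\<forall>x. x \<notin> K \<longrightarrow> \<phi> x = 0))"

definition H01 :: "'a::euclidean_space set \<Rightarrow> ('a \<Rightarrow> real) \<Rightarrow> ('a \<Rightarrow> 'a) \<Rightarrow> bool" where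
  "H01 \<Omega> u G \<longleftrightarrow>
     u \<in> borel_measurable lebesgue \<and> G \<in> borel_measurable lebesgue \<and>
     (\<exists>\<phi> \<psi>. (\<forall>n. test_fun \<Omega> (\<phi> n) (\<psi> n)) \<and>
        (\<lambda>n. \<integral>\<^sup>+ x\<in>\<Omega>. ennreal ((\<phi> n x - u x)\<^sup>2) \<partial>lebesgue) \<longlonglongrightarrow> 0 \<and>
        (\<lambda>n. \<integral>\<^sup>+ x\<in>\<Omega>. ennreal ((norm (\<psi> n x - G x))\<^sup>2) \<partial>lebesgue) \<longlonglongrightarrow> 0)"

definition lambda1 :: "'a::euclidean_space set \<Rightarrow> real" where
  "lambda1 \<Omega> = Inf {enn2real (\<integral>\<^sup>+ x\<in>\<Omega>. ennreal ((norm (G x))\<^sup>2) \<partial>lebesgue)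
                    / enn2real (\<integral>\<^sup>+ x\<in>\<Omega>. ennreal ((u x)\<^sup>2) \<partial>lebesgue) | u G.
                    H01 \<Omega> u G \<and> (\<integral>\<^sup>+ x\<in>\<Omega>. ennreal ((u x)\<^sup>2) \<partial>lebesgue) \<noteq> 0}"

text \<open>Weak solution of -Delta v = 1, v in H_0^1(Omega).\<close>
definition torsion_sol :: "'a::euclidean_space set \<Rightarrow> ('a \<Rightarrow> real) \<Rightarrow> ('a \<Rightarrow> 'a) \<Rightarrow> bool" where
  "torsion_sol \<Omega> v G \<longleftrightarrow> H01 \<Omega> v G \<and>
     (\<forall>\<phi> \<psi>. test_fun \<Omega> \<phi> \<psi> \<longrightarrow>
        (\<integral>x\<in>\<Omega>. G x \<bullet> \<psi> x \<partial>lebesgue) = (\<integral>x\<in>\<Omega>. \<phi> x \<partial>lebesgue))"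

text \<open>L^p norm on Omega of the torsion function (independent of the a.e. representative).\<close>
definition torsion_Lp_norm :: "real \<Rightarrow> 'a::euclidean_space set \<Rightarrow> real" where
  "torsion_Lp_norm p \<Omega> = (THE N. \<exists>v G. torsion_sol \<Omega> v G \<and>
      N = enn2real (\<integral>\<^sup>+ x\<in>\<Omega>. ennreal (\<bar>v x\<bar> powr p) \<partial>lebesgue) powr (1 / p))"

definition F :: "real \<Rightarrow> 'a::euclidean_space set \<Rightarrow> real" where
  "F p \<Omega> = torsion_Lp_norm p \<Omega> * lambda1 \<Omega> / (measure lebesgue \<Omega>) powr (1 / p)"

definition F_convex :: "'a::euclidean_space itself \<Rightarrow> real \<Rightarrow> real" where
  "F_convex _ p = Sup {F p \<Omega> | \<Omega> :: 'a set. open \<Omega> \<and> convex \<Omega> \<and>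
      0 < emeasure lebesgue \<Omega> \<and> emeasure lebesgue \<Omega> < \<infinity>}"

end

theory Submission
  imports Defs
begin

text \<open>
  Write \<open>\<lambda>\<close> for the first eigenvalue and \<open>v\<close> for the torsion function. Testing the equation with \<open>v\<close>
  itself gives \<open>\<integral>|Dv|\<^sup>2 = \<integral>v\<close>, so \<open>\<lambda> \<integral>v\<^sup>2 \<le> \<integral>v\<close>. Young's inequality
  \<open>t powr p \<le> (2 - p) t + (p - 1) t\<^sup>2\<close> at \<open>t = \<lambda> |v|\<close> integrates to
  \<open>\<integral>(\<lambda> |v|) powr p \<le> \<lambda> \<integral>|v|\<close>, which is \<open>F p \<Omega> powr p \<le> F 1 \<Omega>\<close>; and \<open>F 1 \<Omega> \<le> 1\<close> by
  Cauchy-Schwarz, so the suprema are finite. Existence and uniqueness of \<open>v\<close> rest on the Poincare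
  inequality, which is available because an open convex set of finite measure is bounded.
\<close>

section \<open>Square-integrable functions\<close>

text \<open>The factor \<lambda> in \<open>t = \<lambda> |v|\<close> balances Young's inequality:
  after integration the bound \<open>\<lambda> \<integral>v\<^sup>2 \<le> \<integral>|v|\<close>
  turns the quadratic part into \<open>\<lambda> \<integral>|v|\<close>, so the weights
  \<open>2 - p\<close> and \<open>p - 1\<close> add up to 1 and no constant is lost. The sign of
  \<open>v\<close> is never determined; \<open>\<integral>v \<le> \<integral>|v|\<close> is enough.
  The obstacle lies in the definitions: \<open>F\<close> and \<open>F_convex\<close> are built from
  a definite description and from \<open>Inf\<close> and \<open>Sup\<close> on the reals, which say
  something only once the norm is unique, the Rayleigh quotients are bounded below and the set of
  values is nonempty and bounded above. Since \<open>H01\<close> is a closure by sequences,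
  functions and gradients can be carried along as two separate limits in \<open>L\<^sup>2\<close>;
  completeness of \<open>L\<^sup>2\<close> then suffices, and no Sobolev space has to be
  built.\<close>

definition square_integrable :: "'a measure \<Rightarrow> ('a \<Rightarrow> 'b::euclidean_space) \<Rightarrow> bool" where
  "square_integrable M f \<longleftrightarrow> f \<in> borel_measurable M \<and> integrable M (\<lambda>x. (norm (f x))\<^sup>2)"

lemma square_integrable_measurable [measurable_dest]:
  "square_integrable M f \<Longrightarrow> f \<in> borel_measurable M"
  by (simp add: square_integrable_def)

lemma square_integrable_norm:
  "square_integrable M f \<Longrightarrow> integrable M (\<lambda>x. (norm (f x))\<^sup>2)"
  by (simp add: square_integrable_def)

lemma nn_integral_square_integrable:
  assumes "square_integrable M f"
  shows "(\<integral>\<^sup>+ x. ennreal ((norm (f x))\<^sup>2) \<partial>M) = ennreal (\<integral>x. (norm (f x))\<^sup>2 \<partial>M)"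
  using assms by (intro nn_integral_eq_integral) (auto simp: square_integrable_def)

lemma square_integrableI_nn:
  assumes "f \<in> borel_measurable M" "(\<integral>\<^sup>+ x. ennreal ((norm (f x))\<^sup>2) \<partial>M) < \<infinity>"
  shows "square_integrable M f"
  using assms unfolding square_integrable_def
  by (auto intro!: integrableI_nonneg)

lemma norm_add_square_le:
  fixes a b :: "'b::real_inner"
  shows "(norm (a + b))\<^sup>2 \<le> 2 * (norm a)\<^sup>2 + 2 * (norm b)\<^sup>2"
proof -
  have "(norm (a + b))\<^sup>2 + (norm (a - b))\<^sup>2 = 2 * (norm a)\<^sup>2 + 2 * (norm b)\<^sup>2"
    by (simp add: power2_norm_eq_inner inner_simps inner_commute)
  then show ?thesis
    by (smt (verit) zero_le_power2)
qed

lemma square_integrable_scaleR: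
  assumes "square_integrable M f"
  shows "square_integrable M (\<lambda>x. c *\<^sub>R f x)"
  using assms by (auto simp: square_integrable_def power_mult_distrib)

lemma square_integrable_add:
  assumes [measurable]: "square_integrable M f" "square_integrable M g"
  shows "square_integrable M (\<lambda>x. f x + g x)"
  unfolding square_integrable_def
proof
  show "integrable M (\<lambda>x. (norm (f x + g x))\<^sup>2)"
  proof (rule Bochner_Integration.integrable_bound)
    show "integrable M (\<lambda>x. 2 * (norm (f x))\<^sup>2 + 2 * (norm (g x))\<^sup>2)"
      using assms by (auto simp: square_integrable_def)
  qed (auto intro!: AE_I2 norm_add_square_le)
qed simp

lemma square_integrable_diff:
  assumes "square_integrable M f" "square_integrable M g"
  shows "square_integrable M (\<lambda>x. f x - g x)"
  using square_integrable_add[OF assms(1) square_integrable_scaleR[OF assms(2), of "-1"]]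
  by simp

lemma square_integrable_inner:
  assumes [measurable]: "square_integrable M f" "square_integrable M g"
  shows "integrable M (\<lambda>x. f x \<bullet> g x)"
proof -
  have "(\<lambda>x. f x \<bullet> g x) = (\<lambda>x. ((norm (f x + g x))\<^sup>2 - (norm (f x))\<^sup>2 - (norm (g x))\<^sup>2) / 2)"
    by (simp add: fun_eq_iff power2_norm_eq_inner inner_simps inner_commute)
  then show ?thesis
    using square_integrable_norm[OF square_integrable_add[OF assms]]
      assms[THEN square_integrable_norm] by simp
qed

lemma square_integrable_const:
  assumes "finite_measure M"
  shows "square_integrable M (\<lambda>x. c)"
proof -
  interpret finite_measure M by fact
  show ?thesis
    by (auto simp: square_integrable_def)
qed

lemma integral_norm_add_scaleR_square:
  assumes "square_integrable M f" "square_integrable M g"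
  shows "(\<integral>x. (norm (f x + t *\<^sub>R g x))\<^sup>2 \<partial>M)
    = (\<integral>x. (norm (f x))\<^sup>2 \<partial>M) + 2 * t * (\<integral>x. f x \<bullet> g x \<partial>M) + t\<^sup>2 * (\<integral>x. (norm (g x))\<^sup>2 \<partial>M)"
proof -
  have "(norm (f x + t *\<^sub>R g x))\<^sup>2 = (norm (f x))\<^sup>2 + 2 * t * (f x \<bullet> g x) + t\<^sup>2 * (norm (g x))\<^sup>2" for x
    unfolding power2_norm_eq_inner
    by (simp add: inner_simps inner_commute algebra_simps power2_eq_square)
  then show ?thesis
    using assms[THEN square_integrable_norm] square_integrable_inner[OF assms]
    by simp
qed

text \<open>The polynomial \<open>t \<mapsto> \<integral>|f + t g|\<^sup>2\<close> is nonnegative.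
  With \<open>b = \<integral>|g|\<^sup>2\<close> nonzero, its minimiser \<open>- c / b\<close> gives
  the claim; with \<open>b = 0\<close> it is affine, so its slope must vanish.\<close>

lemma Cauchy_Schwarz_integral:
  assumes "square_integrable M f" "square_integrable M g"
  shows "(\<integral>x. f x \<bullet> g x \<partial>M)\<^sup>2 \<le> (\<integral>x. (norm (f x))\<^sup>2 \<partial>M) * (\<integral>x. (norm (g x))\<^sup>2 \<partial>M)"
proof -
  define a b c where "a = (\<integral>x. (norm (f x))\<^sup>2 \<partial>M)" and "b = (\<integral>x. (norm (g x))\<^sup>2 \<partial>M)"
    and "c = (\<integral>x. f x \<bullet> g x \<partial>M)"
  have quad: "0 \<le> a + 2 * t * c + t\<^sup>2 * b" for t
    using integral_norm_add_scaleR_square[OF assms, of t, symmetric]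
    by (simp add: a_def b_def c_def)
  have "b \<ge> 0" by (simp add: b_def)
  have "c\<^sup>2 \<le> a * b"
  proof (cases "b = 0")
    case True
    have "c = 0"
    proof (rule ccontr)
      assume "c \<noteq> 0"
      \<comment> \<open>This \<open>t\<close> makes \<open>a + 2 * t * c\<close> equal to
        -1.\<close>
      then show False
        using quad[of "- (a + 1) / (2 * c)"] True by (simp add: field_simps)
    qed
    then show ?thesis using True by simp
  next
    case False
    then show ?thesis
      using quad[of "- c / b"] \<open>b \<ge> 0\<close> by (simp add: field_simps power2_eq_square)
  qed
  then show ?thesis by (simp add: a_def b_def c_def)
qed

section \<open>Convergence and completeness in the space of square-integrable functions\<close>

text \<open>Square integrability is built in because the Bochner integral of a non-integrable
  function is 0, so the limit condition alone could hold vacuously.\<close>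

definition L2_lim :: "'a measure \<Rightarrow> (nat \<Rightarrow> 'a \<Rightarrow> 'b::euclidean_space) \<Rightarrow> ('a \<Rightarrow> 'b) \<Rightarrow> bool" where
  "L2_lim M f g \<longleftrightarrow> (\<forall>n. square_integrable M (f n)) \<and> square_integrable M g \<and>
    (\<lambda>n. \<integral>x. (norm (f n x - g x))\<^sup>2 \<partial>M) \<longlonglongrightarrow> 0"

text \<open>Link to \<open>H01\<close>, which measures distances by nonnegative integrals and does
  not assume the limit to be square integrable. That property comes for free: some
  \<open>f n\<close> has finite distance to \<open>g\<close>, and
  \<open>g = f n - (f n - g)\<close>.\<close>

lemma L2_lim_iff_nn_integral:
  assumes f: "\<And>n. square_integrable M (f n)" and g [measurable]: "g \<in> borel_measurable M"
  shows "L2_lim M f g \<longleftrightarrow> (\<lambda>n. \<integral>\<^sup>+ x. ennreal ((norm (f n x - g x))\<^sup>2) \<partial>M) \<longlonglongrightarrow> 0"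
    (is "_ \<longleftrightarrow> ?nn \<longlonglongrightarrow> 0")
proof -
  have eq: "?nn = (\<lambda>n. ennreal (\<integral>x. (norm (f n x - g x))\<^sup>2 \<partial>M))" if "square_integrable M g"
    by (intro ext nn_integral_square_integrable square_integrable_diff f that)
  have sq: "square_integrable M g" if "?nn \<longlonglongrightarrow> 0"
  proof -
    have "\<forall>\<^sub>F n in sequentially. ?nn n < 1"
      by (rule order_tendstoD(2)[OF that]) simp
    then obtain n where "?nn n < 1"
      using eventually_happens'[OF sequentially_bot] by blast
    then have "?nn n < \<infinity>"
      by (rule order_less_trans) simp
    then have "square_integrable M (\<lambda>x. f n x - g x)"
      using square_integrable_measurable[OF f] by (intro square_integrableI_nn) auto
    from square_integrable_diff[OF f[of n] this] show ?thesis by simp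
  qed
  show ?thesis
  proof
    assume "L2_lim M f g"
    then have g: "square_integrable M g" and lim: "(\<lambda>n. \<integral>x. (norm (f n x - g x))\<^sup>2 \<partial>M) \<longlonglongrightarrow> 0"
      by (auto simp: L2_lim_def)
    show "?nn \<longlonglongrightarrow> 0"
      unfolding eq[OF g] using tendsto_ennrealI[OF lim] by simp
  next
    assume nn: "?nn \<longlonglongrightarrow> 0"
    then have "(\<lambda>n. ennreal (\<integral>x. (norm (f n x - g x))\<^sup>2 \<partial>M)) \<longlonglongrightarrow> ennreal 0"
      unfolding eq[OF sq[OF nn]] by simp
    then have "(\<lambda>n. \<integral>x. (norm (f n x - g x))\<^sup>2 \<partial>M) \<longlonglongrightarrow> 0"
      by (subst (asm) tendsto_ennreal_iff) auto
    then show "L2_lim M f g"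
      using f sq[OF nn] by (simp add: L2_lim_def)
  qed
qed

lemma L2_lim_inner:
  assumes "L2_lim M f g" "square_integrable M h"
  shows "(\<lambda>n. \<integral>x. f n x \<bullet> h x \<partial>M) \<longlonglongrightarrow> (\<integral>x. g x \<bullet> h x \<partial>M)"
proof -
  have f: "\<And>n. square_integrable M (f n)" and g: "square_integrable M g"
    and lim: "(\<lambda>n. \<integral>x. (norm (f n x - g x))\<^sup>2 \<partial>M) \<longlonglongrightarrow> 0"
    using assms by (auto simp: L2_lim_def)
  have eq: "(\<integral>x. (f n x - g x) \<bullet> h x \<partial>M) = (\<integral>x. f n x \<bullet> h x \<partial>M) - (\<integral>x. g x \<bullet> h x \<partial>M)" for n
    using square_integrable_inner[OF f assms(2)] square_integrable_inner[OF g assms(2)]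
    by (simp add: inner_diff_left)
  have "(\<lambda>n. (\<integral>x. (norm (f n x - g x))\<^sup>2 \<partial>M) * (\<integral>x. (norm (h x))\<^sup>2 \<partial>M)) \<longlonglongrightarrow> 0"
    using tendsto_mult_right[OF lim] by simp
  then have "(\<lambda>n. (\<integral>x. (f n x - g x) \<bullet> h x \<partial>M)\<^sup>2) \<longlonglongrightarrow> 0"
    by (rule tendsto_sandwich[OF _ _ tendsto_const, rotated 2])
      (simp_all add: Cauchy_Schwarz_integral[OF square_integrable_diff[OF f g] assms(2)])
  from tendsto_real_sqrt[OF this] have "(\<lambda>n. \<bar>\<integral>x. (f n x - g x) \<bullet> h x \<partial>M\<bar>) \<longlonglongrightarrow> 0"
    by simp
  then have "(\<lambda>n. (\<integral>x. f n x \<bullet> h x \<partial>M) - (\<integral>x. g x \<bullet> h x \<partial>M)) \<longlonglongrightarrow> 0"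
    unfolding eq tendsto_rabs_zero_iff .
  then show ?thesis
    by (simp add: LIM_zero_iff)
qed

lemma L2_lim_norm:
  assumes "L2_lim M f g"
  shows "(\<lambda>n. \<integral>x. (norm (f n x))\<^sup>2 \<partial>M) \<longlonglongrightarrow> (\<integral>x. (norm (g x))\<^sup>2 \<partial>M)"
proof -
  have f: "\<And>n. square_integrable M (f n)" and g: "square_integrable M g"
    and lim: "(\<lambda>n. \<integral>x. (norm (f n x - g x))\<^sup>2 \<partial>M) \<longlonglongrightarrow> 0"
    using assms by (auto simp: L2_lim_def)
  have "(\<integral>x. (norm (f n x))\<^sup>2 \<partial>M) = (\<integral>x. (norm (f n x - g x))\<^sup>2 \<partial>M)
    + 2 * (\<integral>x. f n x \<bullet> g x \<partial>M) - (\<integral>x. (norm (g x))\<^sup>2 \<partial>M)" for n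
    using integral_norm_add_scaleR_square[OF f g, of n "-1"] by simp
  moreover have "(\<lambda>n. (\<integral>x. (norm (f n x - g x))\<^sup>2 \<partial>M)
    + 2 * (\<integral>x. f n x \<bullet> g x \<partial>M) - (\<integral>x. (norm (g x))\<^sup>2 \<partial>M)) \<longlonglongrightarrow>
    0 + 2 * (\<integral>x. g x \<bullet> g x \<partial>M) - (\<integral>x. (norm (g x))\<^sup>2 \<partial>M)"
    by (intro tendsto_intros lim L2_lim_inner[OF assms g])
  ultimately show ?thesis
    by (simp add: power2_norm_eq_inner)
qed

lemma L2_lim_diff:
  assumes "L2_lim M f g" "L2_lim M f' g'"
  shows "L2_lim M (\<lambda>n x. f n x - f' n x) (\<lambda>x. g x - g' x)"
proof -
  have f: "square_integrable M (f n)" "square_integrable M (f' n)" for n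
    using assms by (auto simp: L2_lim_def)
  have g: "square_integrable M g" "square_integrable M g'"
    using assms by (auto simp: L2_lim_def)
  note d = square_integrable_diff[OF f(1) g(1)] square_integrable_diff[OF f(2) g(2)]
  have "(\<integral>x. (norm (f n x - f' n x - (g x - g' x)))\<^sup>2 \<partial>M)
      \<le> (\<integral>x. 2 * (norm (f n x - g x))\<^sup>2 + 2 * (norm (f' n x - g' x))\<^sup>2 \<partial>M)" for n
  proof (rule integral_mono)
    show "integrable M (\<lambda>x. (norm (f n x - f' n x - (g x - g' x)))\<^sup>2)"
      by (intro square_integrable_norm square_integrable_diff f g)
    show "integrable M (\<lambda>x. 2 * (norm (f n x - g x))\<^sup>2 + 2 * (norm (f' n x - g' x))\<^sup>2)"
      using d[THEN square_integrable_norm] by auto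
    show "(norm (f n x - f' n x - (g x - g' x)))\<^sup>2
        \<le> 2 * (norm (f n x - g x))\<^sup>2 + 2 * (norm (f' n x - g' x))\<^sup>2" for x
      using norm_add_square_le[of "f n x - g x" "g' x - f' n x"]
      by (simp add: norm_minus_commute algebra_simps)
  qed
  then have le: "(\<integral>x. (norm (f n x - f' n x - (g x - g' x)))\<^sup>2 \<partial>M)
      \<le> 2 * (\<integral>x. (norm (f n x - g x))\<^sup>2 \<partial>M) + 2 * (\<integral>x. (norm (f' n x - g' x))\<^sup>2 \<partial>M)" for n
    using d[THEN square_integrable_norm] by simp
  have lim: "(\<lambda>n. \<integral>x. (norm (f n x - g x))\<^sup>2 \<partial>M) \<longlonglongrightarrow> 0"
    "(\<lambda>n. \<integral>x. (norm (f' n x - g' x))\<^sup>2 \<partial>M) \<longlonglongrightarrow> 0"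
    using assms by (simp_all add: L2_lim_def)
  have "(\<lambda>n. 2 * (\<integral>x. (norm (f n x - g x))\<^sup>2 \<partial>M) + 2 * (\<integral>x. (norm (f' n x - g' x))\<^sup>2 \<partial>M))
      \<longlonglongrightarrow> 0"
    using tendsto_add[OF tendsto_mult_left[OF lim(1)] tendsto_mult_left[OF lim(2)], of 2 2] by simp
  then have "(\<lambda>n. \<integral>x. (norm (f n x - f' n x - (g x - g' x)))\<^sup>2 \<partial>M) \<longlonglongrightarrow> 0"
    by (rule tendsto_sandwich[OF _ _ tendsto_const, rotated 2]) (simp_all add: le)
  then show ?thesis
    unfolding L2_lim_def by (simp add: square_integrable_diff f g)
qed

text \<open>Riesz-Fischer. Along a fast subsequence the squared increments integrate to less than
  \<open>(1/4) ^ k\<close>, so even with the weights \<open>2 ^ k\<close> their sum has a finite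
  integral and is finite almost everywhere. This forces pointwise convergence of the subsequence,
  and Fatou's lemma upgrades it to convergence of the whole sequence in
  \<open>L\<^sup>2\<close>.\<close>

lemma L2_complete:
  fixes f :: "nat \<Rightarrow> 'a \<Rightarrow> 'b::euclidean_space"
  assumes f: "\<And>n. square_integrable M (f n)"
    and cauchy: "\<And>e. e > 0 \<Longrightarrow> \<exists>N. \<forall>m\<ge>N. \<forall>n\<ge>N. (\<integral>x. (norm (f m x - f n x))\<^sup>2 \<partial>M) < e"
  shows "\<exists>g. L2_lim M f g"
proof -
  note [measurable] = square_integrable_measurable[OF f]
  have nn: "(\<integral>\<^sup>+ x. ennreal ((norm (f m x - f n x))\<^sup>2) \<partial>M)
      = ennreal (\<integral>x. (norm (f m x - f n x))\<^sup>2 \<partial>M)" for m n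
    by (intro nn_integral_square_integrable square_integrable_diff f)
  have "\<forall>k. \<exists>N. \<forall>m\<ge>N. \<forall>n\<ge>N. (\<integral>x. (norm (f m x - f n x))\<^sup>2 \<partial>M) < (1/4) ^ k"
    by (intro allI cauchy) simp
  then obtain N where N: "\<And>k m n. N k \<le> m \<Longrightarrow> N k \<le> n \<Longrightarrow>
      (\<integral>x. (norm (f m x - f n x))\<^sup>2 \<partial>M) < (1/4) ^ k"
    by (elim choice[THEN exE]) blast
  \<comment> \<open>The sum dominates every \<open>N i\<close> with \<open>i \<le> k\<close>, so
    \<open>r k\<close> and \<open>r (Suc k)\<close> both lie beyond \<open>N k\<close> without
    \<open>N\<close> being monotone; the summand \<open>k\<close> makes \<open>r\<close>
    unbounded.\<close>
  define r where "r k = k + (\<Sum>i\<le>k. N i)" for k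
  have "N k \<le> (\<Sum>i\<le>k. N i)" for k
    by (rule member_le_sum) auto
  then have r1: "N k \<le> r k" for k
    unfolding r_def by (rule trans_le_add2)
  have r2: "N k \<le> r (Suc k)" for k
    using r1[of k] by (simp add: r_def)
  have r3: "k \<le> r k" for k
    by (simp add: r_def)
  define d where "d k x = f (r (Suc k)) x - f (r k) x" for k x
  have [measurable]: "d k \<in> borel_measurable M" for k
    unfolding d_def by measurable
  have "(\<integral>\<^sup>+ x. (\<Sum>k. ennreal (2 ^ k * (norm (d k x))\<^sup>2)) \<partial>M)
      = (\<Sum>k. \<integral>\<^sup>+ x. ennreal (2 ^ k * (norm (d k x))\<^sup>2) \<partial>M)"
    by (intro nn_integral_suminf) auto
  also have "\<dots> \<le> (\<Sum>k. ennreal ((1/2) ^ k))"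
  proof (intro suminf_le summableI)
    fix k
    have "(\<integral>\<^sup>+ x. ennreal (2 ^ k * (norm (d k x))\<^sup>2) \<partial>M)
        = ennreal (2 ^ k) * (\<integral>\<^sup>+ x. ennreal ((norm (d k x))\<^sup>2) \<partial>M)"
      by (simp add: ennreal_mult nn_integral_cmult del: ennreal_power ennreal_numeral)
    also have "\<dots> \<le> ennreal (2 ^ k) * ennreal ((1/4) ^ k)"
      unfolding d_def nn using N[OF r2 r1, of k]
      by (intro mult_left_mono ennreal_leI) auto
    also have "\<dots> = ennreal ((1/2) ^ k)"
      by (subst ennreal_mult[symmetric]) (auto simp: power_mult_distrib[symmetric])
    finally show "(\<integral>\<^sup>+ x. ennreal (2 ^ k * (norm (d k x))\<^sup>2) \<partial>M) \<le> ennreal ((1/2) ^ k)" .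
  qed
  also have "\<dots> < \<infinity>"
    by (subst suminf_ennreal2) (auto simp: summable_geometric)
  finally have fin: "(\<integral>\<^sup>+ x. (\<Sum>k. ennreal (2 ^ k * (norm (d k x))\<^sup>2)) \<partial>M) \<noteq> \<infinity>"
    by (rule less_imp_neq)
  have "AE x in M. (\<Sum>k. ennreal (2 ^ k * (norm (d k x))\<^sup>2)) \<noteq> \<infinity>"
    by (rule nn_integral_PInf_AE[OF _ fin]) measurable
  then have conv: "AE x in M. convergent (\<lambda>k. f (r k) x)"
  proof eventually_elim
    case (elim x)
    then have "summable (\<lambda>k. 2 ^ k * (norm (d k x))\<^sup>2)"
      by (intro summable_suminf_not_top) simp_all
    moreover have "summable (\<lambda>k. (1/2::real) ^ k)"
      by (simp add: summable_geometric)
    ultimately have sum: "summable (\<lambda>k. 2 ^ k * (norm (d k x))\<^sup>2 + (1/2) ^ k)"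
      by (rule summable_add)
    have "summable (\<lambda>k. d k x)"
    proof (rule summable_comparison_test'[OF sum])
      fix k :: nat
      \<comment> \<open>The arithmetic-geometric mean inequality trades the weighted squares and a
        geometric series for absolute summability of the increments.\<close>
      have "0 \<le> 2 ^ k * (norm (d k x) - (1/2) ^ k)\<^sup>2"
        by simp
      also have "\<dots> = 2 ^ k * (norm (d k x))\<^sup>2 - 2 * norm (d k x) + (1/2) ^ k"
        by (simp add: power2_diff algebra_simps power_one_over power2_eq_square)
      finally show "norm (d k x) \<le> 2 ^ k * (norm (d k x))\<^sup>2 + (1/2) ^ k"
        using norm_ge_zero[of "d k x"] by linarith
    qed
    then have "convergent (\<lambda>n. f (r 0) x + (\<Sum>k<n. d k x))"
      by (intro convergent_add convergent_const) (simp add: summable_iff_convergent)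
    then show ?case
      unfolding d_def sum_lessThan_telescope[of "\<lambda>k. f (r k) x"] by simp
  qed
  \<comment> \<open>Where the subsequence diverges, \<open>lim\<close> takes an unspecified value;
    this happens only on a null set, and \<open>g\<close> is measurable all the same.\<close>
  define g where "g x = lim (\<lambda>k. f (r k) x)" for x
  have [measurable]: "g \<in> borel_measurable M"
    unfolding g_def by measurable
  have "(\<lambda>n. \<integral>\<^sup>+ x. ennreal ((norm (f n x - g x))\<^sup>2) \<partial>M) \<longlonglongrightarrow> 0"
  proof (rule order_tendstoI)
    fix a :: ennreal assume "0 < a"
    then obtain b where "0 < b" "b < a"
      using dense by blast
    then obtain e where e: "b = ennreal e" "0 < e"
      by (cases b) auto
    obtain K where K: "\<And>m n. K \<le> m \<Longrightarrow> K \<le> n \<Longrightarrow> (\<integral>x. (norm (f m x - f n x))\<^sup>2 \<partial>M) < e"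
      using cauchy[OF e(2)] by blast
    have "(\<integral>\<^sup>+ x. ennreal ((norm (f n x - g x))\<^sup>2) \<partial>M) < a" if "K \<le> n" for n
    proof -
      have "(\<integral>\<^sup>+ x. ennreal ((norm (f n x - g x))\<^sup>2) \<partial>M)
          = (\<integral>\<^sup>+ x. liminf (\<lambda>k. ennreal ((norm (f n x - f (r k) x))\<^sup>2)) \<partial>M)"
      proof (rule nn_integral_cong_AE, use conv in eventually_elim)
        case (elim x)
        then have "(\<lambda>k. f (r k) x) \<longlonglongrightarrow> g x"
          by (simp add: g_def convergent_LIMSEQ_iff)
        then have "(\<lambda>k. ennreal ((norm (f n x - f (r k) x))\<^sup>2)) \<longlonglongrightarrow> ennreal ((norm (f n x - g x))\<^sup>2)"
          by (intro tendsto_intros tendsto_ennrealI)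
        then show ?case
          by (rule lim_imp_Liminf[OF sequentially_bot, symmetric])
      qed
      also have "\<dots> \<le> liminf (\<lambda>k. \<integral>\<^sup>+ x. ennreal ((norm (f n x - f (r k) x))\<^sup>2) \<partial>M)"
        by (rule nn_integral_liminf) measurable
      also have "\<dots> \<le> liminf (\<lambda>k. ennreal e)"
      proof (rule Liminf_mono, rule eventually_sequentiallyI)
        fix k assume "K \<le> k"
        then have "K \<le> r k"
          using r3 order_trans by blast
        then show "(\<integral>\<^sup>+ x. ennreal ((norm (f n x - f (r k) x))\<^sup>2) \<partial>M) \<le> ennreal e"
          unfolding nn using K[OF that] by (intro ennreal_leI less_imp_le)
      qed
      also have "\<dots> < a"
        using \<open>b < a\<close> by (simp add: e Liminf_const)
      finally show ?thesis .
    qed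
    then show "\<forall>\<^sub>F n in sequentially. (\<integral>\<^sup>+ x. ennreal ((norm (f n x - g x))\<^sup>2) \<partial>M) < a"
      by (rule eventually_sequentiallyI)
  qed simp
  then have "L2_lim M f g"
    by (subst L2_lim_iff_nn_integral[OF f]) auto
  then show ?thesis by blast
qed

section \<open>Weak solutions in a space with a Poincare inequality\<close>

text \<open>\<open>T \<phi> \<psi>\<close> stands for: \<open>\<phi>\<close> is an admissible function with gradient \<open>\<psi>\<close>.\<close>

locale poincare_space = finite_measure M for M :: "'a measure" +
  fixes T :: "('a \<Rightarrow> real) \<Rightarrow> ('a \<Rightarrow> 'b::euclidean_space) \<Rightarrow> bool" and C :: real
  assumes zero: "T (\<lambda>_. 0) (\<lambda>_. 0)"
    and add: "T \<phi> \<psi> \<Longrightarrow> T \<phi>' \<psi>' \<Longrightarrow> T (\<lambda>x. \<phi> x + \<phi>' x) (\<lambda>x. \<psi> x + \<psi>' x)"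
    and scale: "T \<phi> \<psi> \<Longrightarrow> T (\<lambda>x. c * \<phi> x) (\<lambda>x. c *\<^sub>R \<psi> x)"
    and square_integrable_fun: "T \<phi> \<psi> \<Longrightarrow> square_integrable M \<phi>"
    and square_integrable_grad: "T \<phi> \<psi> \<Longrightarrow> square_integrable M \<psi>"
    and C_nonneg: "0 \<le> C"
    and poincare: "T \<phi> \<psi> \<Longrightarrow> (\<integral>x. (\<phi> x)\<^sup>2 \<partial>M) \<le> C * (\<integral>x. (norm (\<psi> x))\<^sup>2 \<partial>M)"
begin

text \<open>This is \<open>torsion_sol\<close> with integrals over \<open>M\<close> in place of set
  integrals over \<Omega>. One sequence has to approximate \<open>v\<close> and \<open>G\<close> at
  the same time, which is what makes \<open>G\<close> the gradient of \<open>v\<close>.\<close>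

definition weak_solution :: "('a \<Rightarrow> real) \<Rightarrow> ('a \<Rightarrow> 'b) \<Rightarrow> bool" where
  "weak_solution v G \<longleftrightarrow>
    (\<exists>\<phi> \<psi>. (\<forall>n. T (\<phi> n) (\<psi> n)) \<and> L2_lim M \<phi> v \<and> L2_lim M \<psi> G) \<and>
    (\<forall>\<phi> \<psi>. T \<phi> \<psi> \<longrightarrow> (\<integral>x. G x \<bullet> \<psi> x \<partial>M) = (\<integral>x. \<phi> x \<partial>M))"

lemma diff: "T \<phi> \<psi> \<Longrightarrow> T \<phi>' \<psi>' \<Longrightarrow> T (\<lambda>x. \<phi> x - \<phi>' x) (\<lambda>x. \<psi> x - \<psi>' x)"
  using add[of \<phi> \<psi> "\<lambda>x. - \<phi>' x" "\<lambda>x. - \<psi>' x"] scale[of \<phi>' \<psi>' "-1"] by simp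

lemma square_integrable_imp_integrable: "square_integrable M (\<phi> :: 'a \<Rightarrow> real) \<Longrightarrow> integrable M \<phi>"
  using square_integrable_inner[OF _ square_integrable_const[OF finite_measure_axioms, of 1], of \<phi>]
  by simp

lemma L2_lim_integral:
  fixes v :: "'a \<Rightarrow> real"
  assumes "L2_lim M \<phi> v"
  shows "(\<lambda>n. \<integral>x. \<phi> n x \<partial>M) \<longlonglongrightarrow> (\<integral>x. v x \<partial>M)"
  using L2_lim_inner[OF assms square_integrable_const[OF finite_measure_axioms, of 1]] by simp

text \<open>The solution is only a limit of admissible functions, so the equation is tested with the
  approximants \<open>\<phi> n\<close>, and both sides pass to the limit.\<close>

lemma weak_solution_energy:
  assumes "weak_solution v G"
  shows "(\<integral>x. (norm (G x))\<^sup>2 \<partial>M) = (\<integral>x. v x \<partial>M)"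
proof -
  obtain \<phi> \<psi> where T: "\<And>n. T (\<phi> n) (\<psi> n)" and v: "L2_lim M \<phi> v" and G: "L2_lim M \<psi> G"
    and weak: "\<And>\<phi> \<psi>. T \<phi> \<psi> \<Longrightarrow> (\<integral>x. G x \<bullet> \<psi> x \<partial>M) = (\<integral>x. \<phi> x \<partial>M)"
    using assms by (auto simp: weak_solution_def)
  have "(\<lambda>n. \<integral>x. \<psi> n x \<bullet> G x \<partial>M) \<longlonglongrightarrow> (\<integral>x. (norm (G x))\<^sup>2 \<partial>M)"
    using L2_lim_inner[OF G, of G] G by (simp add: L2_lim_def power2_norm_eq_inner)
  then have "(\<lambda>n. \<integral>x. \<phi> n x \<partial>M) \<longlonglongrightarrow> (\<integral>x. (norm (G x))\<^sup>2 \<partial>M)"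
    using weak[OF T] by (simp add: inner_commute)
  then show ?thesis
    using L2_lim_integral[OF v] LIMSEQ_unique by blast
qed

text \<open>The difference solves the homogeneous equation; testing with its own approximants shows
  that its gradient has norm 0, and the Poincare inequality survives the passage to the
  limit.\<close>

lemma weak_solution_unique:
  assumes "weak_solution v G" "weak_solution v' G'"
  shows "AE x in M. v x = v' x"
proof -
  obtain \<phi> \<psi> where T: "\<And>n. T (\<phi> n) (\<psi> n)" and v: "L2_lim M \<phi> v" and G: "L2_lim M \<psi> G"
    and weak: "\<And>\<phi> \<psi>. T \<phi> \<psi> \<Longrightarrow> (\<integral>x. G x \<bullet> \<psi> x \<partial>M) = (\<integral>x. \<phi> x \<partial>M)"
    using assms(1) by (auto simp: weak_solution_def)
  obtain \<phi>' \<psi>' where T': "\<And>n. T (\<phi>' n) (\<psi>' n)" and v': "L2_lim M \<phi>' v'" and G': "L2_lim M \<psi>' G'"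
    and weak': "\<And>\<phi> \<psi>. T \<phi> \<psi> \<Longrightarrow> (\<integral>x. G' x \<bullet> \<psi> x \<partial>M) = (\<integral>x. \<phi> x \<partial>M)"
    using assms(2) by (auto simp: weak_solution_def)
  define w H where "w x = v x - v' x" and "H x = G x - G' x" for x
  define \<xi> \<eta> where "\<xi> n x = \<phi> n x - \<phi>' n x" and "\<eta> n x = \<psi> n x - \<psi>' n x" for n x
  have w: "L2_lim M \<xi> w" and H: "L2_lim M \<eta> H"
    unfolding w_def H_def \<xi>_def \<eta>_def using v v' G G' by (auto intro: L2_lim_diff)
  have sq: "square_integrable M G" "square_integrable M G'" "square_integrable M w"
    "square_integrable M H"
    using G G' w H by (auto simp: L2_lim_def)
  have \<xi>\<eta>: "T (\<xi> n) (\<eta> n)" for n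
    unfolding \<xi>_def \<eta>_def by (intro diff T T')
  have "(\<integral>x. \<eta> n x \<bullet> H x \<partial>M) = 0" for n
  proof -
    have "(\<integral>x. H x \<bullet> \<eta> n x \<partial>M) = (\<integral>x. G x \<bullet> \<eta> n x \<partial>M) - (\<integral>x. G' x \<bullet> \<eta> n x \<partial>M)"
      unfolding H_def inner_diff_left
      by (intro Bochner_Integration.integral_diff square_integrable_inner sq
          square_integrable_grad[OF \<xi>\<eta>])
    then show ?thesis
      using weak[OF \<xi>\<eta>] weak'[OF \<xi>\<eta>] by (simp add: inner_commute)
  qed
  then have "(\<integral>x. H x \<bullet> H x \<partial>M) = 0"
    using L2_lim_inner[OF H sq(4)] by (simp add: LIMSEQ_const_iff)
  then have H0: "(\<integral>x. (norm (H x))\<^sup>2 \<partial>M) = 0"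
    by (simp add: power2_norm_eq_inner)
  have "(\<integral>x. (norm (w x))\<^sup>2 \<partial>M) \<le> C * (\<integral>x. (norm (H x))\<^sup>2 \<partial>M)"
    by (rule LIMSEQ_le[OF L2_lim_norm[OF w] tendsto_mult_left[OF L2_lim_norm[OF H]]])
      (use poincare[OF \<xi>\<eta>] in auto)
  then have "(\<integral>x. (norm (w x))\<^sup>2 \<partial>M) = 0"
    using H0 by (simp add: antisym)
  then have "AE x in M. (norm (w x))\<^sup>2 = 0"
    by (subst (asm) integral_nonneg_eq_0_iff_AE) (auto intro: square_integrable_norm[OF sq(3), simplified])
  then show ?thesis
    by (simp add: w_def)
qed

text \<open>A minimising sequence of the energy \<open>J\<close> has Cauchy gradients by the parallelogram law, hence is
  itself Cauchy by the Poincare inequality; the weak equation is the Euler-Lagrange equation.\<close>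

lemma weak_solution_exists: "\<exists>v G. weak_solution v G"
proof -
  define J where "J \<phi> \<psi> = (\<integral>x. (norm (\<psi> x))\<^sup>2 \<partial>M) - 2 * (\<integral>x. \<phi> x \<partial>M)"
    for \<phi> :: "'a \<Rightarrow> real" and \<psi> :: "'a \<Rightarrow> 'b"
  define V where "V = {J \<phi> \<psi> | \<phi> \<psi>. T \<phi> \<psi>}"
  define d where "d = Inf V"
  define K where "K = C * measure M (space M)"
  have K: "K \<ge> 0"
    using C_nonneg by (simp add: K_def)
  \<comment> \<open>With \<open>s = \<integral>\<phi>\<close>, Cauchy-Schwarz and Poincare give
    \<open>s\<^sup>2 \<le> K E\<close>; completing the square in
    \<open>s\<^sup>2 / (K + 1) - 2 s\<close> yields the bound. The constant is \<open>K + 1\<close>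
    because \<open>K\<close> may be 0.\<close>
  have "- (K + 1) \<le> J \<phi> \<psi>" if T: "T \<phi> \<psi>" for \<phi> \<psi>
  proof -
    define E s where "E = (\<integral>x. (norm (\<psi> x))\<^sup>2 \<partial>M)" and "s = (\<integral>x. \<phi> x \<partial>M)"
    have "s\<^sup>2 \<le> (\<integral>x. (\<phi> x)\<^sup>2 \<partial>M) * measure M (space M)"
      using Cauchy_Schwarz_integral[OF square_integrable_fun[OF T]
          square_integrable_const[OF finite_measure_axioms, of 1]]
      by (simp add: s_def)
    also have "\<dots> \<le> K * E"
      using mult_right_mono[OF poincare[OF T], of "measure M (space M)"]
      by (simp add: K_def E_def mult_ac)
    also have "\<dots> \<le> (K + 1) * E"
      by (simp add: E_def distrib_right)
    finally have "s\<^sup>2 / (K + 1) \<le> E"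
      using K by (simp add: field_simps)
    moreover have "0 \<le> (s - (K + 1))\<^sup>2 / (K + 1)"
      using K by simp
    moreover have "(s - (K + 1))\<^sup>2 / (K + 1) = s\<^sup>2 / (K + 1) - 2 * s + (K + 1)"
      using K by (simp add: field_simps power2_eq_square)
    ultimately show ?thesis
      by (simp add: J_def E_def s_def)
  qed
  then have bdd: "bdd_below V"
    by (auto simp: V_def intro!: bdd_belowI)
  have ne: "V \<noteq> {}"
    using zero by (auto simp: V_def)
  have d: "d \<le> J \<phi> \<psi>" if "T \<phi> \<psi>" for \<phi> \<psi>
    unfolding d_def by (rule cInf_lower[OF _ bdd]) (use that in \<open>auto simp: V_def\<close>)
  have "\<exists>\<phi> \<psi>. T \<phi> \<psi> \<and> J \<phi> \<psi> < d + 1 / Suc n" for n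
    using cInf_lessD[OF ne, of "d + 1 / Suc n"] by (auto simp: d_def V_def)
  then obtain \<phi> \<psi> where T: "\<And>n. T (\<phi> n) (\<psi> n)" and J: "\<And>n. J (\<phi> n) (\<psi> n) < d + 1 / Suc n"
    by metis
  note sq = square_integrable_fun[OF T] square_integrable_grad[OF T]
  \<comment> \<open>The parallelogram law in terms of energies: the left side equals
    \<open>2 J\<^sub>m + 2 J\<^sub>n - 4 J'\<close>, where \<open>J'\<close> is the energy of the
    midpoint; the linear terms cancel. Now \<open>J' \<ge> d\<close>, and each of the other energies
    exceeds \<open>d\<close> by less than \<open>1 / Suc m\<close> or
    \<open>1 / Suc n\<close>.\<close>
  have grad: "(\<integral>x. (norm (\<psi> m x - \<psi> n x))\<^sup>2 \<partial>M) < 2 / Suc m + 2 / Suc n" for m n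
  proof -
    define a b c where "a = (\<integral>x. (norm (\<psi> m x))\<^sup>2 \<partial>M)" and "b = (\<integral>x. (norm (\<psi> n x))\<^sup>2 \<partial>M)"
      and "c = (\<integral>x. \<psi> m x \<bullet> \<psi> n x \<partial>M)"
    have eq: "(\<integral>x. (norm (\<psi> m x + t *\<^sub>R \<psi> n x))\<^sup>2 \<partial>M) = a + 2 * t * c + t\<^sup>2 * b" for t
      using integral_norm_add_scaleR_square[OF sq(2) sq(2)] by (simp add: a_def b_def c_def)
    have "(\<integral>x. (norm ((1/2) *\<^sub>R (\<psi> m x + \<psi> n x)))\<^sup>2 \<partial>M) = (1/4) * (\<integral>x. (norm (\<psi> m x + \<psi> n x))\<^sup>2 \<partial>M)"
      by (simp add: power_divide)
    also have "\<dots> = (a + 2 * c + b) / 4"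
      using eq[of 1] by simp
    finally have "J (\<lambda>x. (1/2) * (\<phi> m x + \<phi> n x)) (\<lambda>x. (1/2) *\<^sub>R (\<psi> m x + \<psi> n x))
        = (a + 2 * c + b) / 4 - (\<integral>x. \<phi> m x \<partial>M) - (\<integral>x. \<phi> n x \<partial>M)"
      using square_integrable_imp_integrable[OF sq(1)] unfolding J_def by (simp add: add_divide_distrib)
    moreover have "d \<le> J (\<lambda>x. (1/2) * (\<phi> m x + \<phi> n x)) (\<lambda>x. (1/2) *\<^sub>R (\<psi> m x + \<psi> n x))"
      by (intro d scale add T)
    moreover have "(\<integral>x. (norm (\<psi> m x - \<psi> n x))\<^sup>2 \<partial>M) = a - 2 * c + b"
      using eq[of "-1"] by simp
    moreover have "J (\<phi> m) (\<psi> m) = a - 2 * (\<integral>x. \<phi> m x \<partial>M)" "J (\<phi> n) (\<psi> n) = b - 2 * (\<integral>x. \<phi> n x \<partial>M)"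
      by (simp_all add: J_def a_def b_def)
    moreover define x y where "x = 1 / real (Suc m)" and "y = 1 / real (Suc n)"
    ultimately have "(\<integral>x. (norm (\<psi> m x - \<psi> n x))\<^sup>2 \<partial>M) < 2 * x + 2 * y"
      using J[of m, folded x_def] J[of n, folded y_def] by (simp add: field_simps)
    then show ?thesis
      by (simp add: x_def y_def)
  qed
  have small: "\<exists>N. \<forall>m\<ge>N. \<forall>n\<ge>N. B * (2 / Suc m + 2 / Suc n) < e" if "e > 0" "B > 0" for e B :: real
  proof -
    obtain N where N: "4 * B / e < real N"
      using reals_Archimedean2 by blast
    have "B * (2 / Suc m + 2 / Suc n) < e" if "N \<le> m" "N \<le> n" for m n
    proof -
      have le: "2 / Suc k \<le> 2 / Suc N" if "N \<le> k" for k
        using that by (intro divide_left_mono) auto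
      have "B * (2 / Suc m + 2 / Suc n) \<le> B * (2 / Suc N + 2 / Suc N)"
        using le[OF \<open>N \<le> m\<close>] le[OF \<open>N \<le> n\<close>] \<open>B > 0\<close> by (intro mult_left_mono add_mono) auto
      also have "\<dots> = 4 * B / Suc N"
        by simp
      also have "\<dots> < e"
        using N \<open>e > 0\<close> by (simp add: field_simps)
      finally show ?thesis .
    qed
    then show ?thesis by blast
  qed
  have "\<exists>N. \<forall>m\<ge>N. \<forall>n\<ge>N. (\<integral>x. (norm (\<psi> m x - \<psi> n x))\<^sup>2 \<partial>M) < e" if e: "e > 0" for e
  proof -
    obtain N where N: "\<forall>m\<ge>N. \<forall>n\<ge>N. 1 * (2 / Suc m + 2 / Suc n) < e"
      using small[OF e zero_less_one] by blast
    show ?thesis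
      by (intro exI[of _ N] allI impI, rule less_trans[OF grad]) (use N in simp)
  qed
  then obtain G where G: "L2_lim M \<psi> G"
    using L2_complete[of M \<psi>] sq(2) by blast
  \<comment> \<open>\<open>C\<close> is enlarged to \<open>C + 1\<close> because
    \<open>small\<close> asks for a positive factor.\<close>
  have val: "(\<integral>x. (norm (\<phi> m x - \<phi> n x))\<^sup>2 \<partial>M) \<le> (C + 1) * (2 / Suc m + 2 / Suc n)" for m n
  proof -
    have "(\<integral>x. (norm (\<phi> m x - \<phi> n x))\<^sup>2 \<partial>M) \<le> C * (\<integral>x. (norm (\<psi> m x - \<psi> n x))\<^sup>2 \<partial>M)"
      using poincare[OF diff[OF T T]] by simp
    also have "\<dots> \<le> (C + 1) * (2 / Suc m + 2 / Suc n)"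
      using C_nonneg grad[of m n] by (intro mult_mono) auto
    finally show ?thesis .
  qed
  have "\<exists>N. \<forall>m\<ge>N. \<forall>n\<ge>N. (\<integral>x. (norm (\<phi> m x - \<phi> n x))\<^sup>2 \<partial>M) < e" if "e > 0" for e
  proof -
    have "C + 1 > 0"
      using C_nonneg by simp
    from small[OF that this] obtain N
      where N: "\<forall>m\<ge>N. \<forall>n\<ge>N. (C + 1) * (2 / Suc m + 2 / Suc n) < e"
      by blast
    show ?thesis
      by (intro exI[of _ N] allI impI, rule le_less_trans[OF val]) (use N in simp)
  qed
  then obtain v where v: "L2_lim M \<phi> v"
    using L2_complete[of M \<phi>] sq(1) by blast
  have "(\<integral>x. G x \<bullet> \<eta> x \<partial>M) = (\<integral>x. \<xi> x \<partial>M)" if \<xi>\<eta>: "T \<xi> \<eta>" for \<xi> \<eta>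
  proof -
    define X E where "X = (\<integral>x. G x \<bullet> \<eta> x \<partial>M) - (\<integral>x. \<xi> x \<partial>M)" and "E = (\<integral>x. (norm (\<eta> x))\<^sup>2 \<partial>M)"
    \<comment> \<open>The energy of the limit is never formed: \<open>\<phi> n\<close> is perturbed
      by \<open>t * \<xi>\<close>, which cannot lower the energy below \<open>d\<close>, and the
      error \<open>1 / Suc n\<close> disappears in the limit.\<close>
    have nonneg: "0 \<le> 2 * t * X + t\<^sup>2 * E" for t
    proof -
      have "0 \<le> 1 / Suc n + 2 * t * ((\<integral>x. \<psi> n x \<bullet> \<eta> x \<partial>M) - (\<integral>x. \<xi> x \<partial>M)) + t\<^sup>2 * E" for n
      proof -
        have "J (\<lambda>x. \<phi> n x + t * \<xi> x) (\<lambda>x. \<psi> n x + t *\<^sub>R \<eta> x)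
            = J (\<phi> n) (\<psi> n) + 2 * t * ((\<integral>x. \<psi> n x \<bullet> \<eta> x \<partial>M) - (\<integral>x. \<xi> x \<partial>M)) + t\<^sup>2 * E"
          unfolding J_def E_def
            integral_norm_add_scaleR_square[OF sq(2) square_integrable_grad[OF \<xi>\<eta>]]
          using square_integrable_imp_integrable[OF sq(1)] square_integrable_imp_integrable[OF square_integrable_fun[OF \<xi>\<eta>]]
          by (simp add: algebra_simps)
        moreover have "d \<le> J (\<lambda>x. \<phi> n x + t * \<xi> x) (\<lambda>x. \<psi> n x + t *\<^sub>R \<eta> x)"
          by (intro d scale add T \<xi>\<eta>)
        ultimately show ?thesis
          using J[of n] by linarith
      qed
      moreover have "(\<lambda>n. 1 / Suc n + 2 * t * ((\<integral>x. \<psi> n x \<bullet> \<eta> x \<partial>M) - (\<integral>x. \<xi> x \<partial>M)) + t\<^sup>2 * E)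
          \<longlonglongrightarrow> 0 + 2 * t * X + t\<^sup>2 * E"
        unfolding X_def
        by (intro tendsto_add tendsto_mult tendsto_diff tendsto_const
            L2_lim_inner[OF G square_integrable_grad[OF \<xi>\<eta>]] LIMSEQ_Suc[OF lim_1_over_n])
      ultimately show ?thesis
        using LIMSEQ_le_const[of _ "0 + 2 * t * X + t\<^sup>2 * E" 0] by simp
    qed
    have E: "E \<ge> 0" by (simp add: E_def)
    \<comment> \<open>A near-minimiser of \<open>2 * t * X + t\<^sup>2 * E\<close>, with
      \<open>E + 1\<close> in case \<open>E = 0\<close>. At this \<open>t\<close> the expression is
      \<open>- t\<^sup>2 * (E + 2)\<close>, which forces \<open>t = 0\<close> and hence
      \<open>X = 0\<close>.\<close>
    define t where "t = - X / (E + 1)"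
    have X: "X = - (t * (E + 1))"
      using E by (simp add: t_def)
    have "t\<^sup>2 * (E + 2) \<le> 0"
      using nonneg[of t] unfolding X by (simp add: algebra_simps power2_eq_square)
    then have "X = 0"
      unfolding X using E by (simp add: mult_le_0_iff)
    then show ?thesis by (simp add: X_def)
  qed
  then have "weak_solution v G"
    using T v G by (auto simp: weak_solution_def)
  then show ?thesis by blast
qed

end

section \<open>The Poincare inequality for test functions\<close>

lemma integrable_compact_support:
  fixes f :: "'a::euclidean_space \<Rightarrow> 'b::{banach, second_countable_topology}"
  assumes "continuous_on UNIV f" "compact K" "\<And>x. x \<notin> K \<Longrightarrow> f x = 0"
  shows "integrable lborel f"
proof -
  have "integrable lborel (\<lambda>x. indicator K x *\<^sub>R f x)"
    using assms by (intro borel_integrable_compact) (auto intro: continuous_on_subset)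
  also have "(\<lambda>x. indicator K x *\<^sub>R f x) = f"
    using assms(3) by (auto simp: indicator_def)
  finally show ?thesis .
qed

lemma gradient_zero_outside_support:
  fixes f :: "'a::euclidean_space \<Rightarrow> real"
  assumes "\<And>x. (f has_derivative (\<lambda>h. g x \<bullet> h)) (at x)"
    and "compact K" "\<And>x. x \<notin> K \<Longrightarrow> f x = 0" "x \<notin> K"
  shows "g x = 0"
proof -
  have "((\<lambda>x. 0) has_derivative (\<lambda>h. g x \<bullet> h)) (at x)"
    by (rule has_derivative_transform_within_open[OF assms(1), where s = "- K"])
      (use assms compact_imp_closed in \<open>auto simp: open_Compl\<close>)
  then have "(\<lambda>h. g x \<bullet> h) = (\<lambda>h. 0)"
    by (rule has_derivative_unique) simp
  then show ?thesis
    by (metis inner_eq_zero_iff)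
qed

text \<open>Translation invariance of the Lebesgue measure makes the integral of every difference
  quotient vanish.\<close>

lemma integral_directional_derivative:
  fixes f :: "'a::euclidean_space \<Rightarrow> real"
  assumes g: "continuous_on UNIV g"
    and deriv: "\<And>x. (f has_derivative (\<lambda>h. g x \<bullet> h)) (at x)"
    and K: "compact K" "\<And>x. x \<notin> K \<Longrightarrow> f x = 0"
  shows "(\<integral>x. g x \<bullet> e \<partial>lborel) = 0"
proof -
  have g0: "x \<notin> K \<Longrightarrow> g x = 0" for x
    using gradient_zero_outside_support[OF deriv K] by simp
  have cont_f: "continuous_on UNIV f"
    by (rule has_derivative_continuous_on) (use deriv in simp)
  have [measurable]: "f \<in> borel_measurable borel" "g \<in> borel_measurable borel"
    using cont_f g by (auto intro: borel_measurable_continuous_onI)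
  have int_f: "integrable lborel f"
    by (rule integrable_compact_support[OF cont_f K])
  obtain B where "\<And>x. x \<in> K \<Longrightarrow> norm (g x) \<le> B"
    using compact_imp_bounded[OF compact_continuous_image[OF continuous_on_subset[OF g] K(1)]]
    by (auto simp: bounded_iff)
  \<comment> \<open>The maximum with 0 covers an empty \<open>K\<close>, for which \<open>B\<close>
    may be negative.\<close>
  then have B: "norm (g x) \<le> max B 0" for x
    using g0[of x] by (cases "x \<in> K") (auto simp: le_max_iff_disj)
  have lip: "\<bar>f y - f x\<bar> \<le> max B 0 * norm (y - x)" for x y
  proof -
    have "norm (f y - f x) \<le> max B 0 * norm (y - x)"
    proof (rule differentiable_bound[where S=UNIV])
      show "onorm ((\<bullet>) (g x)) \<le> max B 0" for x
        using onorm_inner_right[OF bounded_linear_ident, of "g x"] B[of x] by (simp add: onorm_id)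
    qed (use deriv in auto)
    then show ?thesis by simp
  qed
  obtain R where R: "\<And>x. x \<in> K \<Longrightarrow> norm x \<le> R"
    using compact_imp_bounded[OF K(1)] by (auto simp: bounded_iff)
  define h where "h n = 1 / real (Suc n)" for n
  have h: "0 < h n" "h n \<le> 1" for n
    by (auto simp: h_def)
  define s where "s n x = (f (x + h n *\<^sub>R e) - f x) / h n" for n x
  \<comment> \<open>Dominating function: the Lipschitz bound controls each difference quotient, and
    since \<open>h n \<le> 1\<close> the quotients vanish outside the ball enlarged by
    \<open>norm e\<close>.\<close>
  define w :: "'a \<Rightarrow> real" where "w x = indicator (cball 0 (R + norm e)) x *\<^sub>R (max B 0 * norm e)" for x
  have shift: "integrable lborel (\<lambda>x. f (x + c))" "(\<integral>x. f (x + c) \<partial>lborel) = (\<integral>x. f x \<partial>lborel)" for c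
  proof -
    have eq: "lborel = distr lborel borel ((+) c)"
      by (rule lborel_distr_plus[symmetric])
    show "integrable lborel (\<lambda>x. f (x + c))"
      using int_f by (subst (asm) eq) (simp add: integrable_distr_eq add.commute)
    show "(\<integral>x. f (x + c) \<partial>lborel) = (\<integral>x. f x \<partial>lborel)"
      by (subst (2) eq) (simp add: integral_distr add.commute)
  qed
  have "(\<integral>x. s n x \<partial>lborel) = 0" for n
    unfolding s_def using shift int_f by simp
  moreover have "(\<lambda>n. \<integral>x. s n x \<partial>lborel) \<longlonglongrightarrow> (\<integral>x. g x \<bullet> e \<partial>lborel)"
  proof (rule integral_dominated_convergence[where w=w])
    show "integrable lborel w"
      unfolding w_def by (intro borel_integrable_compact) auto
    show "AE x in lborel. (\<lambda>n. s n x) \<longlonglongrightarrow> g x \<bullet> e"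
    proof (rule AE_I2)
      fix x
      have "((\<lambda>t. f (x + t *\<^sub>R e)) has_derivative (\<lambda>t. g x \<bullet> (t *\<^sub>R e))) (at 0)"
        by (rule has_derivative_compose[of "\<lambda>t. x + t *\<^sub>R e" "\<lambda>t. t *\<^sub>R e" 0 UNIV f])
          (auto intro!: derivative_eq_intros deriv)
      then have "((\<lambda>t. f (x + t *\<^sub>R e)) has_real_derivative g x \<bullet> e) (at 0)"
        by (simp add: has_field_derivative_def mult_commute_abs)
      then have "((\<lambda>t. (f (x + t *\<^sub>R e) - f x) / t) \<longlongrightarrow> g x \<bullet> e) (at 0)"
        by (simp add: DERIV_def)
      moreover have "filterlim h (at 0) sequentially"
      proof (rule filterlim_atI)
        show "h \<longlonglongrightarrow> 0"
          unfolding h_def by (rule LIMSEQ_Suc[OF lim_1_over_n])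
        show "\<forall>\<^sub>F n in sequentially. h n \<noteq> 0"
          using h(1) by (simp add: less_imp_neq[symmetric])
      qed
      ultimately show "(\<lambda>n. s n x) \<longlonglongrightarrow> g x \<bullet> e"
        unfolding s_def by (rule filterlim_compose)
    qed
    show "AE x in lborel. norm (s n x) \<le> w x" for n
    proof (rule AE_I2)
      fix x
      have "\<bar>f (x + h n *\<^sub>R e) - f x\<bar> \<le> h n * (max B 0 * norm e)"
        using lip[of "x + h n *\<^sub>R e" x] h[of n] by (simp add: mult_ac)
      then have le: "norm (s n x) \<le> max B 0 * norm e"
        unfolding s_def using h[of n] by (simp add: field_simps)
      show "norm (s n x) \<le> w x"
      proof (cases "norm x \<le> R + norm e")
        case True
        then show ?thesis using le by (simp add: w_def)
      next
        case False
        have "norm (h n *\<^sub>R e) \<le> norm e"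
          using h[of n] mult_right_mono[of "h n" 1 "norm e"] by simp
        then have "norm x \<le> norm (x + h n *\<^sub>R e) + norm e"
          using norm_triangle_ineq4[of "x + h n *\<^sub>R e" "h n *\<^sub>R e"] by simp
        then have "x \<notin> K" "x + h n *\<^sub>R e \<notin> K"
          using False R[of x] R[of "x + h n *\<^sub>R e"] norm_ge_zero[of e] by linarith+
        then have "s n x = 0"
          by (simp add: s_def K(2))
        then show ?thesis by (simp add: w_def)
      qed
    qed
  qed (auto simp: s_def)
  ultimately show ?thesis
    by (simp add: LIMSEQ_const_iff)
qed

lemma test_fun_continuous:
  assumes "test_fun \<Omega> \<phi> \<psi>"
  shows "continuous_on UNIV \<phi>" "continuous_on UNIV \<psi>"
proof -
  show "continuous_on UNIV \<phi>"
    by (rule has_derivative_continuous_on[where f' = "\<lambda>x h. \<psi> x \<bullet> h"])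
      (use assms in \<open>simp add: test_fun_def\<close>)
  show "continuous_on UNIV \<psi>"
    using assms by (simp add: test_fun_def)
qed

lemma test_fun_support:
  assumes "test_fun \<Omega> \<phi> \<psi>"
  shows "\<exists>K. compact K \<and> K \<subseteq> \<Omega> \<and> (\<forall>x. x \<notin> K \<longrightarrow> \<phi> x = 0) \<and> (\<forall>x. x \<notin> K \<longrightarrow> \<psi> x = 0)"
proof -
  obtain K where K: "compact K" "K \<subseteq> \<Omega>" "\<forall>x. x \<notin> K \<longrightarrow> \<phi> x = 0"
    and d: "\<forall>x. (\<phi> has_derivative (\<lambda>h. \<psi> x \<bullet> h)) (at x)"
    using assms unfolding test_fun_def by blast
  have "\<psi> x = 0" if "x \<notin> K" for x
    by (rule gradient_zero_outside_support[where f = \<phi> and K = K]) (use K d that in simp_all)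
  then show ?thesis
    using K by (intro exI[of _ K]) simp
qed

text \<open>The field \<open>\<phi>\<^sup>2 (x \<bullet> e) e\<close> has compact support, so its divergence
  \<open>\<phi>\<^sup>2 + 2 \<phi> (x \<bullet> e) (\<psi> \<bullet> e)\<close> integrates to zero.\<close>

lemma poincare_slab:
  fixes \<Omega> :: "'a::euclidean_space set"
  assumes T: "test_fun \<Omega> \<phi> \<psi>" and e: "norm e = 1" and R: "\<And>x. x \<in> \<Omega> \<Longrightarrow> \<bar>x \<bullet> e\<bar> \<le> R"
  shows "(\<integral>x. (\<phi> x)\<^sup>2 \<partial>lborel) \<le> 4 * R\<^sup>2 * (\<integral>x. (norm (\<psi> x))\<^sup>2 \<partial>lborel)"
proof -
  obtain K where K: "compact K" "K \<subseteq> \<Omega>" "\<forall>x. x \<notin> K \<longrightarrow> \<phi> x = 0" "\<forall>x. x \<notin> K \<longrightarrow> \<psi> x = 0"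
    using test_fun_support[OF T] by (elim exE conjE)
  note cont = test_fun_continuous[OF T]
  have deriv: "(\<phi> has_derivative (\<lambda>h. \<psi> x \<bullet> h)) (at x)" for x
    using T by (simp add: test_fun_def)
  define g where "g x = (2 * \<phi> x * (x \<bullet> e)) *\<^sub>R \<psi> x + (\<phi> x)\<^sup>2 *\<^sub>R e" for x
  have ee: "e \<bullet> e = 1"
    using e by (simp add: norm_eq_1)
  have "(\<integral>x. g x \<bullet> e \<partial>lborel) = 0"
  proof (rule integral_directional_derivative)
    show "continuous_on UNIV g"
      unfolding g_def by (intro continuous_intros cont)
    show "((\<lambda>x. (\<phi> x)\<^sup>2 * (x \<bullet> e)) has_derivative (\<lambda>h. g x \<bullet> h)) (at x)" for x
      unfolding g_def
      by (auto intro!: derivative_eq_intros deriv simp: algebra_simps inner_simps inner_commute)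
  qed (use K in auto)
  then have div: "(\<integral>x. (\<phi> x)\<^sup>2 + 2 * (\<phi> x * ((x \<bullet> e) * (\<psi> x \<bullet> e))) \<partial>lborel) = 0"
    by (simp add: g_def inner_add_left ee algebra_simps)
  have int: "integrable lborel (\<lambda>x. (\<phi> x)\<^sup>2)" "integrable lborel (\<lambda>x. (norm (\<psi> x))\<^sup>2)"
    "integrable lborel (\<lambda>x. \<phi> x * ((x \<bullet> e) * (\<psi> x \<bullet> e)))"
    by (rule integrable_compact_support[OF _ K(1)]; (intro continuous_intros cont)?; simp add: K)+
  \<comment> \<open>With \<open>q = (x \<bullet> e) (\<psi> \<bullet> e)\<close>, the left integrand
    is at most \<open>\<phi>\<^sup>2 / 2 + 2 q\<^sup>2\<close>. Half of
    \<open>\<integral>\<phi>\<^sup>2\<close> is then absorbed, which doubles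
    \<open>2 R\<^sup>2\<close> to the constant \<open>4 R\<^sup>2\<close>. The bound by
    \<open>R\<close> is available on \<open>K\<close>; elsewhere \<psi> vanishes.\<close>
  have "(\<integral>x. - 2 * (\<phi> x * ((x \<bullet> e) * (\<psi> x \<bullet> e))) \<partial>lborel)
      \<le> (\<integral>x. (\<phi> x)\<^sup>2 / 2 + 2 * R\<^sup>2 * (norm (\<psi> x))\<^sup>2 \<partial>lborel)"
  proof (rule integral_mono)
    fix x
    define q where "q = (x \<bullet> e) * (\<psi> x \<bullet> e)"
    have "q\<^sup>2 \<le> R\<^sup>2 * (norm (\<psi> x))\<^sup>2"
    proof (cases "x \<in> K")
      case True
      then have "(x \<bullet> e)\<^sup>2 \<le> R\<^sup>2"
        using R[of x] K(2) by (intro abs_le_square_iff[THEN iffD1]) auto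
      moreover have "(\<psi> x \<bullet> e)\<^sup>2 \<le> (norm (\<psi> x))\<^sup>2"
        using Cauchy_Schwarz_ineq2[of "\<psi> x" e] e by (intro abs_le_square_iff[THEN iffD1]) auto
      ultimately show ?thesis
        by (simp add: q_def power_mult_distrib mult_mono)
    qed (simp add: K q_def)
    moreover have "0 \<le> (\<phi> x + 2 * q)\<^sup>2"
      by simp
    moreover have "(\<phi> x + 2 * q)\<^sup>2 = (\<phi> x)\<^sup>2 + 4 * (\<phi> x * q) + 4 * q\<^sup>2"
      by (simp add: power2_eq_square algebra_simps)
    ultimately show "- 2 * (\<phi> x * ((x \<bullet> e) * (\<psi> x \<bullet> e))) \<le> (\<phi> x)\<^sup>2 / 2 + 2 * R\<^sup>2 * (norm (\<psi> x))\<^sup>2"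
      unfolding q_def[symmetric] by linarith
  qed (use int in auto)
  then show ?thesis
    using div int by simp
qed

section \<open>Boundedness of open convex sets of finite measure\<close>

text \<open>A far away point of \<open>S\<close> and a ball in \<open>S\<close> span a set that contains many disjoint balls of
  half the radius.\<close>

lemma bounded_convex_finite_measure:
  fixes S :: "'a::euclidean_space set"
  assumes "open S" "convex S" and fin: "emeasure lebesgue S < \<infinity>"
  shows "bounded S"
proof (cases "S = {}")
  case False
  then obtain c where c: "c \<in> S" by blast
  obtain r where r: "r > 0" "ball c r \<subseteq> S"
    using \<open>open S\<close> c open_contains_ball by blast
  define V where "V = unit_ball_vol (real DIM('a)) * (r / 2) ^ DIM('a)"
  have V: "V > 0" using r by (simp add: V_def)
  obtain m where m: "emeasure lebesgue S = ennreal m" "m \<ge> 0"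
    using fin by (cases "emeasure lebesgue S") auto
  obtain N :: nat where N: "m / V < real N"
    using reals_Archimedean2 by blast
  have "N > 0"
    using N m(2) V by (cases N) (auto simp: field_simps)
  have "dist c x \<le> 2 * N * r" if x: "x \<in> S" for x
  proof (rule ccontr)
    assume far: "\<not> dist c x \<le> 2 * N * r"
    \<comment> \<open>The centres fill only the first half of the segment from \<open>c\<close> to
      \<open>x\<close>: there the contraction of \<open>ball c r\<close> towards \<open>x\<close>
      still has radius at least \<open>r / 2\<close>. Neighbouring centres are more than
      \<open>r\<close> apart by the choice of \<open>2 * N * r\<close>.\<close>
    define p where "p k = c + (k / (2 * N)) *\<^sub>R (x - c)" for k :: nat
    have sub: "ball (p k) (r / 2) \<subseteq> S" if "k < N" for k
    proof
      fix y assume "y \<in> ball (p k) (r / 2)"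
      then have u: "norm (y - p k) < r / 2"
        by (simp add: dist_norm norm_minus_commute)
      define t where "t = k / (2 * real N)"
      have t: "0 \<le> t" "t \<le> 1 / 2"
        using that by (simp_all add: t_def divide_le_eq)
      \<comment> \<open>The preimage of \<open>y\<close> under the contraction towards
        \<open>x\<close> with ratio \<open>1 - t\<close>; it lies in \<open>ball c r\<close>, so
        \<open>y\<close> is a convex combination of two points of \<open>S\<close>.\<close>
      define z where "z = c + (1 / (1 - t)) *\<^sub>R (y - p k)"
      have "norm (y - p k) / (1 - t) < r"
      proof -
        have "r / 2 \<le> r * (1 - t)"
          using mult_left_mono[of "1 / 2" "1 - t" r] t r by simp
        then show ?thesis
          using u t by (simp add: pos_divide_less_eq)
      qed
      then have "z \<in> S"
        using r(2) t by (auto simp: z_def dist_norm subset_iff)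
      then have "(1 - t) *\<^sub>R z + t *\<^sub>R x \<in> S"
        using \<open>convex S\<close> x t by (simp add: convex_def)
      also have "(1 - t) *\<^sub>R z + t *\<^sub>R x = y"
      proof -
        have "(1 - t) *\<^sub>R z = (1 - t) *\<^sub>R c + (y - p k)"
          using t by (simp add: z_def scaleR_add_right)
        moreover have "p k = c + t *\<^sub>R (x - c)"
          by (simp add: p_def t_def)
        ultimately show ?thesis
          by (simp add: algebra_simps)
      qed
      finally show "y \<in> S" .
    qed
    have disj: "disjoint_family_on (\<lambda>k. ball (p k) (r / 2)) {..<N}"
      unfolding disjoint_family_on_def
    proof (intro ballI impI)
      fix i j :: nat assume "i \<noteq> j"
      have "r * 1 \<le> (norm (x - c) / (2 * N)) * \<bar>real i - real j\<bar>"
        using far \<open>N > 0\<close> r \<open>i \<noteq> j\<close>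
        by (intro mult_mono) (auto simp: dist_norm norm_minus_commute field_simps)
      also have "\<dots> = norm (p i - p j)"
      proof -
        have "p i - p j = ((real i - real j) / (2 * N)) *\<^sub>R (x - c)"
          by (simp add: p_def diff_divide_distrib algebra_simps)
        then show ?thesis by simp
      qed
      finally have "r \<le> dist (p i) (p j)"
        by (simp add: dist_norm)
      then show "ball (p i) (r / 2) \<inter> ball (p j) (r / 2) = {}"
        by (intro disjoint_ballI) simp
    qed
    have "ennreal (N * V) = (\<Sum>k<N. ennreal V)"
      using V by (simp add: ennreal_mult ennreal_of_nat_eq_real_of_nat)
    also have "\<dots> = (\<Sum>k<N. emeasure lebesgue (ball (p k) (r / 2)))"
      using r by (simp add: V_def emeasure_ball)
    also have "\<dots> = emeasure lebesgue (\<Union>k<N. ball (p k) (r / 2))"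
      by (intro sum_emeasure disj) auto
    also have "\<dots> \<le> ennreal m"
      unfolding m(1)[symmetric] using sub \<open>open S\<close> by (intro emeasure_mono) auto
    finally have "N * V \<le> m"
      using m(2) by simp
    then show False
      using N V by (simp add: field_simps)
  qed
  then show ?thesis
    unfolding bounded_def by blast
qed simp

section \<open>Test functions as a Poincare space\<close>

text \<open>The Poincare inequality was proved for \<open>lborel\<close>, whose translation
  invariance it uses, whereas the torsion problem lives on Lebesgue measure restricted to
  \<Omega>.\<close>

lemma integral_lebesgue_on_compact_support:
  fixes f :: "'a::euclidean_space \<Rightarrow> real"
  assumes "open \<Omega>" "continuous_on UNIV f" "compact K" "K \<subseteq> \<Omega>" "\<And>x. x \<notin> K \<Longrightarrow> f x = 0"
  shows "integrable (lebesgue_on \<Omega>) f" "(\<integral>x. f x \<partial>lebesgue_on \<Omega>) = (\<integral>x. f x \<partial>lborel)"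
proof -
  have eq: "(\<lambda>x. indicator \<Omega> x *\<^sub>R f x) = f"
    using assms(4,5) by (auto simp: indicator_def fun_eq_iff)
  have \<Omega>: "\<Omega> \<inter> space lebesgue \<in> sets lebesgue"
    using assms(1) by simp
  have f: "integrable lborel f"
    by (rule integrable_compact_support[OF assms(2,3,5)])
  show "integrable (lebesgue_on \<Omega>) f"
    unfolding integrable_restrict_space[OF \<Omega>] eq
    using f by (simp add: integrable_completion)
  show "(\<integral>x. f x \<partial>lebesgue_on \<Omega>) = (\<integral>x. f x \<partial>lborel)"
    unfolding integral_restrict_space[OF \<Omega>] eq
    using f by (simp add: integral_completion)
qed

lemma poincare_space_test_fun:
  fixes \<Omega> :: "'a::euclidean_space set"
  assumes "open \<Omega>" "bounded \<Omega>"
  shows "\<exists>C. poincare_space (lebesgue_on \<Omega>) (test_fun \<Omega>) C"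
proof -
  obtain R where R: "\<And>x. x \<in> \<Omega> \<Longrightarrow> norm x \<le> R"
    using assms(2) by (auto simp: bounded_iff)
  \<comment> \<open>A bounded set lies in a slab orthogonal to any basis vector; its half-width
    \<open>R\<close> gives the constant \<open>4 * R\<^sup>2\<close>.\<close>
  obtain e :: 'a where e: "e \<in> Basis"
    using nonempty_Basis by blast
  have sq: "square_integrable (lebesgue_on \<Omega>) f"
    if "continuous_on UNIV f" "compact K" "K \<subseteq> \<Omega>" "\<And>x. x \<notin> K \<Longrightarrow> f x = 0"
    for f :: "'a \<Rightarrow> 'b::euclidean_space" and K
    unfolding square_integrable_def
  proof
    show "f \<in> borel_measurable (lebesgue_on \<Omega>)"
      using that(1) assms(1)
      by (intro continuous_imp_measurable_on_sets_lebesgue continuous_on_subset[OF that(1)]) auto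
    show "integrable (lebesgue_on \<Omega>) (\<lambda>x. (norm (f x))\<^sup>2)"
      by (rule integral_lebesgue_on_compact_support[OF assms(1) _ that(2,3)])
        (auto simp: that intro!: continuous_intros)
  qed
  have fin: "finite_measure (lebesgue_on \<Omega>)"
  proof
    have "emeasure lebesgue \<Omega> < \<infinity>"
      using emeasure_bounded_finite[OF assms(2)] assms(1) by simp
    then show "emeasure (lebesgue_on \<Omega>) (space (lebesgue_on \<Omega>)) \<noteq> \<infinity>"
      using assms(1) by (simp add: emeasure_restrict_space)
  qed
  have "poincare_space (lebesgue_on \<Omega>) (test_fun \<Omega>) (4 * R\<^sup>2)"
  proof (intro poincare_space.intro fin poincare_space_axioms.intro)
    show "test_fun \<Omega> (\<lambda>_. 0) (\<lambda>_. 0)"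
      by (auto simp: test_fun_def intro!: exI[of _ "{}"])
    show "test_fun \<Omega> (\<lambda>x. \<phi> x + \<phi>' x) (\<lambda>x. \<psi> x + \<psi>' x)"
      if T: "test_fun \<Omega> \<phi> \<psi>" "test_fun \<Omega> \<phi>' \<psi>'" for \<phi> \<psi> \<phi>' \<psi>'
    proof -
      obtain K where "compact K" "K \<subseteq> \<Omega>" "\<forall>x. x \<notin> K \<longrightarrow> \<phi> x = 0"
        using test_fun_support[OF T(1)] by (elim exE conjE)
      moreover obtain K' where "compact K'" "K' \<subseteq> \<Omega>" "\<forall>x. x \<notin> K' \<longrightarrow> \<phi>' x = 0"
        using test_fun_support[OF T(2)] by (elim exE conjE)
      ultimately have "\<exists>K. compact K \<and> K \<subseteq> \<Omega> \<and> (\<forall>x. x \<notin> K \<longrightarrow> \<phi> x + \<phi>' x = 0)"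
        by (intro exI[of _ "K \<union> K'"]) auto
      then show ?thesis
        using that unfolding test_fun_def
        by (auto intro!: continuous_intros derivative_eq_intros simp: inner_add_left)
    qed
    show "test_fun \<Omega> (\<lambda>x. c * \<phi> x) (\<lambda>x. c *\<^sub>R \<psi> x)" if "test_fun \<Omega> \<phi> \<psi>" for \<phi> \<psi> c
      using that unfolding test_fun_def
      by (auto intro!: continuous_intros derivative_eq_intros)
    fix \<phi> \<psi> assume T: "test_fun \<Omega> \<phi> \<psi>"
    obtain K where K: "compact K" "K \<subseteq> \<Omega>" "\<forall>x. x \<notin> K \<longrightarrow> \<phi> x = 0" "\<forall>x. x \<notin> K \<longrightarrow> \<psi> x = 0"
      using test_fun_support[OF T] by (elim exE conjE)
    note cont = test_fun_continuous[OF T]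
    show "square_integrable (lebesgue_on \<Omega>) \<phi>" "square_integrable (lebesgue_on \<Omega>) \<psi>"
      by (rule sq[OF _ K(1,2)]; simp add: K cont)+
    have "\<bar>x \<bullet> e\<bar> \<le> R" if "x \<in> \<Omega>" for x
      using Basis_le_norm[OF e, of x] R[OF that] by linarith
    then have "(\<integral>x. (\<phi> x)\<^sup>2 \<partial>lborel) \<le> 4 * R\<^sup>2 * (\<integral>x. (norm (\<psi> x))\<^sup>2 \<partial>lborel)"
      using e by (intro poincare_slab[OF T, of e]) auto
    also have "(\<integral>x. (norm (\<psi> x))\<^sup>2 \<partial>lborel) = (\<integral>x. (norm (\<psi> x))\<^sup>2 \<partial>lebesgue_on \<Omega>)"
      by (rule integral_lebesgue_on_compact_support(2)[symmetric, OF assms(1) _ K(1,2)])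
        (auto simp: K intro!: continuous_intros cont)
    also have "(\<integral>x. (\<phi> x)\<^sup>2 \<partial>lborel) = (\<integral>x. (\<phi> x)\<^sup>2 \<partial>lebesgue_on \<Omega>)"
      by (rule integral_lebesgue_on_compact_support(2)[symmetric, OF assms(1) _ K(1,2)])
        (auto simp: K intro!: continuous_intros cont)
    finally show "(\<integral>x. (\<phi> x)\<^sup>2 \<partial>lebesgue_on \<Omega>) \<le> 4 * R\<^sup>2 * (\<integral>x. (norm (\<psi> x))\<^sup>2 \<partial>lebesgue_on \<Omega>)" .
  qed simp
  then show ?thesis by blast
qed

section \<open>The torsion function\<close>

lemma torsion_sol_imp_weak_solution:
  assumes "poincare_space (lebesgue_on \<Omega>) (test_fun \<Omega>) C" "open \<Omega>" "torsion_sol \<Omega> v G"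
  shows "poincare_space.weak_solution (lebesgue_on \<Omega>) (test_fun \<Omega>) v G"
proof -
  interpret poincare_space "lebesgue_on \<Omega>" "test_fun \<Omega>" C by fact
  have \<Omega>: "\<Omega> \<inter> space lebesgue \<in> sets lebesgue"
    using assms(2) by simp
  obtain \<phi> \<psi> where T: "\<And>n. test_fun \<Omega> (\<phi> n) (\<psi> n)"
    and v: "(\<lambda>n. \<integral>\<^sup>+ x\<in>\<Omega>. ennreal ((\<phi> n x - v x)\<^sup>2) \<partial>lebesgue) \<longlonglongrightarrow> 0"
    and G: "(\<lambda>n. \<integral>\<^sup>+ x\<in>\<Omega>. ennreal ((norm (\<psi> n x - G x))\<^sup>2) \<partial>lebesgue) \<longlonglongrightarrow> 0"
    and meas: "v \<in> borel_measurable lebesgue" "G \<in> borel_measurable lebesgue"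
    and weak: "\<And>\<phi> \<psi>. test_fun \<Omega> \<phi> \<psi> \<Longrightarrow>
        (\<integral>x\<in>\<Omega>. G x \<bullet> \<psi> x \<partial>lebesgue) = (\<integral>x\<in>\<Omega>. \<phi> x \<partial>lebesgue)"
    using assms(3) unfolding torsion_sol_def H01_def by blast
  have "L2_lim (lebesgue_on \<Omega>) \<phi> v"
    using v meas(1) square_integrable_fun[OF T]
    by (subst L2_lim_iff_nn_integral)
      (simp_all add: measurable_restrict_space1 nn_integral_restrict_space[OF \<Omega>])
  moreover have "L2_lim (lebesgue_on \<Omega>) \<psi> G"
    using G meas(2) square_integrable_grad[OF T]
    by (subst L2_lim_iff_nn_integral)
      (simp_all add: measurable_restrict_space1 nn_integral_restrict_space[OF \<Omega>])
  moreover have "(\<integral>x. G x \<bullet> \<psi> x \<partial>lebesgue_on \<Omega>) = (\<integral>x. \<phi> x \<partial>lebesgue_on \<Omega>)"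
    if "test_fun \<Omega> \<phi> \<psi>" for \<phi> \<psi>
    using weak[OF that] by (simp add: integral_restrict_space[OF \<Omega>] set_lebesgue_integral_def)
  ultimately show ?thesis
    using T unfolding weak_solution_def by blast
qed

text \<open>A weak solution is measurable only on \<Omega>, while \<open>H01\<close> asks for
  measurability on the whole space; extension by zero repairs this and changes no integral over
  \<Omega>.\<close>

lemma weak_solution_imp_torsion_sol:
  assumes "poincare_space (lebesgue_on \<Omega>) (test_fun \<Omega>) C" "open \<Omega>"
    and "poincare_space.weak_solution (lebesgue_on \<Omega>) (test_fun \<Omega>) v G"
  shows "torsion_sol \<Omega> (\<lambda>x. indicator \<Omega> x *\<^sub>R v x) (\<lambda>x. indicator \<Omega> x *\<^sub>R G x)"
proof -
  interpret poincare_space "lebesgue_on \<Omega>" "test_fun \<Omega>" C by fact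
  have \<Omega>: "\<Omega> \<inter> space lebesgue \<in> sets lebesgue"
    using assms(2) by simp
  obtain \<phi> \<psi> where T: "\<And>n. test_fun \<Omega> (\<phi> n) (\<psi> n)"
    and v: "L2_lim (lebesgue_on \<Omega>) \<phi> v" and G: "L2_lim (lebesgue_on \<Omega>) \<psi> G"
    and weak: "\<And>\<phi> \<psi>. test_fun \<Omega> \<phi> \<psi> \<Longrightarrow>
        (\<integral>x. G x \<bullet> \<psi> x \<partial>lebesgue_on \<Omega>) = (\<integral>x. \<phi> x \<partial>lebesgue_on \<Omega>)"
    using assms(3) unfolding weak_solution_def by blast
  have meas: "v \<in> borel_measurable (lebesgue_on \<Omega>)" "G \<in> borel_measurable (lebesgue_on \<Omega>)"
    using v G by (auto simp: L2_lim_def square_integrable_def)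
  have "(\<integral>\<^sup>+ x\<in>\<Omega>. ennreal ((\<phi> n x - indicator \<Omega> x *\<^sub>R v x)\<^sup>2) \<partial>lebesgue)
      = (\<integral>\<^sup>+ x. ennreal ((norm (\<phi> n x - v x))\<^sup>2) \<partial>lebesgue_on \<Omega>)" for n
    unfolding nn_integral_restrict_space[OF \<Omega>]
    by (rule nn_integral_cong) (simp add: indicator_def)
  then have v': "(\<lambda>n. \<integral>\<^sup>+ x\<in>\<Omega>. ennreal ((\<phi> n x - indicator \<Omega> x *\<^sub>R v x)\<^sup>2) \<partial>lebesgue) \<longlonglongrightarrow> 0"
    using v L2_lim_iff_nn_integral[OF square_integrable_fun[OF T] meas(1)] by simp
  have "(\<integral>\<^sup>+ x\<in>\<Omega>. ennreal ((norm (\<psi> n x - indicator \<Omega> x *\<^sub>R G x))\<^sup>2) \<partial>lebesgue)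
      = (\<integral>\<^sup>+ x. ennreal ((norm (\<psi> n x - G x))\<^sup>2) \<partial>lebesgue_on \<Omega>)" for n
    unfolding nn_integral_restrict_space[OF \<Omega>]
    by (rule nn_integral_cong) (simp add: indicator_def)
  then have G': "(\<lambda>n. \<integral>\<^sup>+ x\<in>\<Omega>. ennreal ((norm (\<psi> n x - indicator \<Omega> x *\<^sub>R G x))\<^sup>2) \<partial>lebesgue) \<longlonglongrightarrow> 0"
    using G L2_lim_iff_nn_integral[OF square_integrable_grad[OF T] meas(2)] by simp
  have "(\<lambda>x. indicator \<Omega> x *\<^sub>R v x) \<in> borel_measurable lebesgue"
    "(\<lambda>x. indicator \<Omega> x *\<^sub>R G x) \<in> borel_measurable lebesgue"
    using meas by (simp_all only: borel_measurable_restrict_space_iff[OF \<Omega>])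
  then have H01: "H01 \<Omega> (\<lambda>x. indicator \<Omega> x *\<^sub>R v x) (\<lambda>x. indicator \<Omega> x *\<^sub>R G x)"
    unfolding H01_def using T v' G' by blast
  have eq: "(\<integral>x\<in>\<Omega>. (indicator \<Omega> x *\<^sub>R G x) \<bullet> \<psi> x \<partial>lebesgue) = (\<integral>x\<in>\<Omega>. \<phi> x \<partial>lebesgue)"
    if "test_fun \<Omega> \<phi> \<psi>" for \<phi> \<psi>
  proof -
    have "(\<integral>x\<in>\<Omega>. (indicator \<Omega> x *\<^sub>R G x) \<bullet> \<psi> x \<partial>lebesgue) = (\<integral>x. G x \<bullet> \<psi> x \<partial>lebesgue_on \<Omega>)"
      unfolding integral_restrict_space[OF \<Omega>] set_lebesgue_integral_def
      by (rule Bochner_Integration.integral_cong) (simp_all add: indicator_def)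
    then show ?thesis
      using weak[OF that] by (simp add: integral_restrict_space[OF \<Omega>] set_lebesgue_integral_def)
  qed
  show ?thesis
    unfolding torsion_sol_def by (intro conjI allI impI H01 eq)
qed

text \<open>The quotient of \<open>v\<close> itself shows that the set under \<open>Inf\<close> is
  nonempty, which a real infimum needs before any bound can be read off; hence the assumption that
  \<open>v\<close> has nonzero norm.\<close>

lemma lambda1_bound:
  assumes "open \<Omega>" "H01 \<Omega> v G" "square_integrable (lebesgue_on \<Omega>) v" "square_integrable (lebesgue_on \<Omega>) G"
    and "(\<integral>x. (v x)\<^sup>2 \<partial>lebesgue_on \<Omega>) \<noteq> 0"
  shows "0 \<le> lambda1 \<Omega>"
    and "lambda1 \<Omega> * (\<integral>x. (v x)\<^sup>2 \<partial>lebesgue_on \<Omega>) \<le> (\<integral>x. (norm (G x))\<^sup>2 \<partial>lebesgue_on \<Omega>)"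
proof -
  define S where "S = {enn2real (\<integral>\<^sup>+ x\<in>\<Omega>. ennreal ((norm (G x))\<^sup>2) \<partial>lebesgue)
      / enn2real (\<integral>\<^sup>+ x\<in>\<Omega>. ennreal ((u x)\<^sup>2) \<partial>lebesgue) | u G.
      H01 \<Omega> u G \<and> (\<integral>\<^sup>+ x\<in>\<Omega>. ennreal ((u x)\<^sup>2) \<partial>lebesgue) \<noteq> 0}"
  have S: "lambda1 \<Omega> = Inf S"
    by (simp add: lambda1_def S_def)
  have \<Omega>: "\<Omega> \<inter> space lebesgue \<in> sets lebesgue"
    using assms(1) by simp
  define a b where "a = (\<integral>x. (norm (G x))\<^sup>2 \<partial>lebesgue_on \<Omega>)" and "b = (\<integral>x. (v x)\<^sup>2 \<partial>lebesgue_on \<Omega>)"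
  have nonneg: "0 \<le> a" "0 \<le> b"
    by (simp_all add: a_def b_def)
  have a: "(\<integral>\<^sup>+ x\<in>\<Omega>. ennreal ((norm (G x))\<^sup>2) \<partial>lebesgue) = ennreal a"
    using nn_integral_square_integrable[OF assms(4)]
    by (simp add: a_def nn_integral_restrict_space[OF \<Omega>])
  have b: "(\<integral>\<^sup>+ x\<in>\<Omega>. ennreal ((v x)\<^sup>2) \<partial>lebesgue) = ennreal b"
    using nn_integral_square_integrable[OF assms(3)]
    by (simp add: b_def nn_integral_restrict_space[OF \<Omega>])
  have "b > 0"
    using assms(5)[folded b_def] nonneg(2) by linarith
  have "a / b \<in> S"
    unfolding S_def using assms(2) a b \<open>b > 0\<close> nonneg
    by (intro CollectI exI[of _ v] exI[of _ G]) simp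
  moreover have lb: "0 \<le> s" if "s \<in> S" for s
    using that by (auto simp: S_def)
  ultimately have "0 \<le> Inf S" and le: "Inf S \<le> a / b"
    by (auto intro!: cInf_lower cInf_greatest bdd_belowI[of S 0])
  then show "0 \<le> lambda1 \<Omega>"
    by (simp only: S)
  show "lambda1 \<Omega> * (\<integral>x. (v x)\<^sup>2 \<partial>lebesgue_on \<Omega>) \<le> (\<integral>x. (norm (G x))\<^sup>2 \<partial>lebesgue_on \<Omega>)"
    using le \<open>b > 0\<close> unfolding S a_def[symmetric] b_def[symmetric] by (simp only: pos_le_divide_eq)
qed

section \<open>Interpolation between the first and the second power\<close>

text \<open>\<open>x powr p\<close> is the weighted geometric mean of \<open>x\<close> and
  \<open>x\<^sup>2\<close> with weights \<open>2 - p\<close> and \<open>p - 1\<close>; these are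
  nonnegative exactly for \<open>1 \<le> p \<le> 2\<close>.\<close>

lemma powr_le_interpolation:
  fixes x p :: real
  assumes "0 \<le> x" "1 \<le> p" "p \<le> 2"
  shows "x powr p \<le> (2 - p) * x + (p - 1) * x\<^sup>2"
proof (cases "x = 0")
  case False
  then have x: "x > 0" using assms by simp
  have "x powr p = x powr (2 - p) * (x\<^sup>2) powr (p - 1)"
    using x by (simp add: powr_powr powr_add[symmetric] flip: powr_numeral)
  also have "\<dots> \<le> (2 - p) * x + (p - 1) * x\<^sup>2"
    using assms x by (intro Youngs_inequality_0) auto
  finally show ?thesis .
qed simp

text \<open>Replaces the description in \<open>torsion_Lp_norm\<close> by one representative
  \<open>v\<close> that serves all exponents. Uniqueness almost everywhere makes the norm
  independent of the chosen solution.\<close>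

lemma torsion_exists:
  fixes \<Omega> :: "'a::euclidean_space set"
  assumes "open \<Omega>" "bounded \<Omega>"
  shows "\<exists>v. square_integrable (lebesgue_on \<Omega>) v \<and> integrable (lebesgue_on \<Omega>) v \<and>
    (\<forall>p. torsion_Lp_norm p \<Omega> = (\<integral>x. \<bar>v x\<bar> powr p \<partial>lebesgue_on \<Omega>) powr (1 / p)) \<and>
    ((\<integral>x. (v x)\<^sup>2 \<partial>lebesgue_on \<Omega>) \<noteq> 0 \<longrightarrow> 0 \<le> lambda1 \<Omega>) \<and>
    lambda1 \<Omega> * (\<integral>x. (v x)\<^sup>2 \<partial>lebesgue_on \<Omega>) \<le> (\<integral>x. \<bar>v x\<bar> \<partial>lebesgue_on \<Omega>)"
proof -
  obtain C where ps: "poincare_space (lebesgue_on \<Omega>) (test_fun \<Omega>) C"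
    using poincare_space_test_fun[OF assms] by blast
  interpret poincare_space "lebesgue_on \<Omega>" "test_fun \<Omega>" C by fact
  have \<Omega>: "\<Omega> \<inter> space lebesgue \<in> sets lebesgue"
    using assms(1) by simp
  obtain v G where tors: "torsion_sol \<Omega> v G"
    using weak_solution_exists weak_solution_imp_torsion_sol[OF ps assms(1)] by blast
  note weak = torsion_sol_imp_weak_solution[OF ps assms(1) tors]
  have sq: "square_integrable (lebesgue_on \<Omega>) v" "square_integrable (lebesgue_on \<Omega>) G"
    using weak by (auto simp: weak_solution_def L2_lim_def)
  have int: "integrable (lebesgue_on \<Omega>) v"
    by (rule square_integrable_imp_integrable[OF sq(1)])
  have norm: "torsion_Lp_norm p \<Omega> = (\<integral>x. \<bar>v x\<bar> powr p \<partial>lebesgue_on \<Omega>) powr (1 / p)" for p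
  proof -
    have eq: "enn2real (\<integral>\<^sup>+ x\<in>\<Omega>. ennreal (\<bar>w x\<bar> powr p) \<partial>lebesgue) = (\<integral>x. \<bar>v x\<bar> powr p \<partial>lebesgue_on \<Omega>)"
      if w: "torsion_sol \<Omega> w H" for w H
    proof -
      have "AE x in lebesgue_on \<Omega>. w x = v x"
        using weak_solution_unique[OF torsion_sol_imp_weak_solution[OF ps assms(1) w] weak] .
      then have "(\<integral>\<^sup>+ x. ennreal (\<bar>w x\<bar> powr p) \<partial>lebesgue_on \<Omega>) = (\<integral>\<^sup>+ x. ennreal (\<bar>v x\<bar> powr p) \<partial>lebesgue_on \<Omega>)"
        by (intro nn_integral_cong_AE) auto
      \<comment> \<open>This holds for every \<open>p\<close>: if the power is not integrable,
        \<open>enn2real\<close> of infinity and the Bochner integral are both 0.\<close>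
      moreover have "enn2real (\<integral>\<^sup>+ x. ennreal (\<bar>v x\<bar> powr p) \<partial>lebesgue_on \<Omega>) = (\<integral>x. \<bar>v x\<bar> powr p \<partial>lebesgue_on \<Omega>)"
        using square_integrable_measurable[OF sq(1)]
        by (intro integral_eq_nn_integral[symmetric]) auto
      ultimately show ?thesis
        by (simp add: nn_integral_restrict_space[OF \<Omega>])
    qed
    show ?thesis
      unfolding torsion_Lp_norm_def
    proof (rule the_equality)
      show "\<exists>w H. torsion_sol \<Omega> w H \<and> (\<integral>x. \<bar>v x\<bar> powr p \<partial>lebesgue_on \<Omega>) powr (1 / p)
          = enn2real (\<integral>\<^sup>+ x\<in>\<Omega>. ennreal (\<bar>w x\<bar> powr p) \<partial>lebesgue) powr (1 / p)"
        using tors eq[OF tors] by (intro exI[of _ v] exI[of _ G]) simp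
      show "N = (\<integral>x. \<bar>v x\<bar> powr p \<partial>lebesgue_on \<Omega>) powr (1 / p)"
        if "\<exists>w H. torsion_sol \<Omega> w H \<and>
          N = enn2real (\<integral>\<^sup>+ x\<in>\<Omega>. ennreal (\<bar>w x\<bar> powr p) \<partial>lebesgue) powr (1 / p)" for N
        using that eq by auto
    qed
  qed
  have "H01 \<Omega> v G"
    using tors by (simp add: torsion_sol_def)
  note lam = lambda1_bound[OF assms(1) this sq]
  have "(\<integral>x. (norm (G x))\<^sup>2 \<partial>lebesgue_on \<Omega>) \<le> (\<integral>x. \<bar>v x\<bar> \<partial>lebesgue_on \<Omega>)"
    unfolding weak_solution_energy[OF weak] using int by (intro integral_mono) auto
  \<comment> \<open>If \<open>v\<close> has norm 0, nothing is known about \<open>lambda1\<close>,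
    but the left side is then 0.\<close>
  then have rayleigh: "lambda1 \<Omega> * (\<integral>x. (v x)\<^sup>2 \<partial>lebesgue_on \<Omega>) \<le> (\<integral>x. \<bar>v x\<bar> \<partial>lebesgue_on \<Omega>)"
    using lam(2) by (cases "(\<integral>x. (v x)\<^sup>2 \<partial>lebesgue_on \<Omega>) = 0") auto
  show ?thesis
    by (intro exI[of _ v] conjI allI impI sq(1) int norm lam(1) rayleigh)
qed

lemma F_interpolation:
  fixes \<Omega> :: "'a::euclidean_space set"
  assumes "open \<Omega>" "bounded \<Omega>" "0 < emeasure lebesgue \<Omega>" and p: "1 \<le> p" "p \<le> 2"
  shows "F p \<Omega> \<le> F 1 \<Omega> powr (1 / p)" "0 \<le> F 1 \<Omega>" "F 1 \<Omega> \<le> 1"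
proof -
  obtain v where sq: "square_integrable (lebesgue_on \<Omega>) v" and int: "integrable (lebesgue_on \<Omega>) v"
    and norm: "\<forall>p. torsion_Lp_norm p \<Omega> = (\<integral>x. \<bar>v x\<bar> powr p \<partial>lebesgue_on \<Omega>) powr (1 / p)"
    and nonneg: "(\<integral>x. (v x)\<^sup>2 \<partial>lebesgue_on \<Omega>) \<noteq> 0 \<longrightarrow> 0 \<le> lambda1 \<Omega>"
    and rayleigh: "lambda1 \<Omega> * (\<integral>x. (v x)\<^sup>2 \<partial>lebesgue_on \<Omega>) \<le> (\<integral>x. \<bar>v x\<bar> \<partial>lebesgue_on \<Omega>)"
    using torsion_exists[OF assms(1,2)] by (elim exE conjE) (rule that; assumption)
  define L m I1 I2 Ip where "L = lambda1 \<Omega>" and "m = measure lebesgue \<Omega>"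
    and "I1 = (\<integral>x. \<bar>v x\<bar> \<partial>lebesgue_on \<Omega>)" and "I2 = (\<integral>x. (v x)\<^sup>2 \<partial>lebesgue_on \<Omega>)"
    and "Ip = (\<integral>x. \<bar>v x\<bar> powr p \<partial>lebesgue_on \<Omega>)"
  have fin: "emeasure lebesgue \<Omega> < \<infinity>"
    using emeasure_bounded_finite[OF assms(2)] assms(1) by simp
  have m: "m > 0"
    using assms(3) fin by (auto simp: m_def measure_def enn2real_positive_iff)
  have ge0: "I1 \<ge> 0" "I2 \<ge> 0" "Ip \<ge> 0"
    by (simp_all add: I1_def I2_def Ip_def)
  have F1: "F 1 \<Omega> = I1 * L / m"
    using ge0 m by (simp add: F_def norm I1_def L_def m_def)
  have Fp: "F p \<Omega> = Ip powr (1 / p) * L / m powr (1 / p)"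
    by (simp add: F_def norm Ip_def L_def m_def)
  have sq_int: "integrable (lebesgue_on \<Omega>) (\<lambda>x. (v x)\<^sup>2)"
    using square_integrable_norm[OF sq] by simp
  have fm: "finite_measure (lebesgue_on \<Omega>)"
    using fin assms(1) by (intro finite_measureI) (simp add: emeasure_restrict_space)
  have "F p \<Omega> \<le> F 1 \<Omega> powr (1 / p) \<and> 0 \<le> F 1 \<Omega> \<and> F 1 \<Omega> \<le> 1"
  \<comment> \<open>The sign of \<open>L\<close> is known only for nonzero \<open>I2\<close>. In the
    degenerate case \<open>v\<close> vanishes almost everywhere, so both values of \<open>F\<close>
    are 0 whatever \<open>L\<close> is.\<close>
  proof (cases "I2 = 0")
    case True
    then have "AE x in lebesgue_on \<Omega>. (v x)\<^sup>2 = 0"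
      using sq_int unfolding I2_def by (subst (asm) integral_nonneg_eq_0_iff_AE) auto
    then have v0: "AE x in lebesgue_on \<Omega>. v x = 0"
      by simp
    have [measurable]: "v \<in> borel_measurable (lebesgue_on \<Omega>)"
      using sq by (rule square_integrable_measurable)
    have "I1 = 0"
      unfolding I1_def by (rule integral_eq_zero_AE) (use v0 in auto)
    moreover have "Ip = 0"
      unfolding Ip_def by (rule integral_eq_zero_AE) (use v0 in auto)
    ultimately show ?thesis
      by (simp add: F1 Fp)
  next
    case False
    then have L: "L \<ge> 0"
      using nonneg by (simp add: I2_def L_def)
    have ray: "L * I2 \<le> I1"
      using rayleigh by (simp add: L_def I1_def I2_def)
    \<comment> \<open>Cauchy-Schwarz against 1 gives \<open>I1\<^sup>2 \<le> I2 * m\<close>; after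
      multiplication by \<open>L\<close> the Rayleigh bound replaces \<open>L * I2\<close> by
      \<open>I1\<close>, and one factor \<open>I1\<close> cancels.\<close>
    have "I1 * L \<le> m"
    proof (cases "I1 = 0")
      case False
      have "square_integrable (lebesgue_on \<Omega>) (\<lambda>x. \<bar>v x\<bar>)"
        using sq by (auto simp: square_integrable_def)
      from Cauchy_Schwarz_integral[OF this square_integrable_const[OF fm, of 1]]
      have "I1\<^sup>2 \<le> I2 * m"
        using assms(1) by (simp add: I1_def I2_def m_def measure_restrict_space)
      then have "L * I1\<^sup>2 \<le> (L * I2) * m"
        using mult_left_mono[OF _ L] by (simp add: mult.assoc)
      also have "\<dots> \<le> I1 * m"
        using ray m by (intro mult_right_mono) auto
      finally show ?thesis
        using False ge0(1) by (simp add: power2_eq_square mult_ac)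
    qed (use m in simp)
    then have F1_le: "F 1 \<Omega> \<le> 1"
      using m by (simp add: F1)
    have "L powr p * Ip \<le> L * I1"
    proof -
      have "L powr p * Ip = (\<integral>x. (L * \<bar>v x\<bar>) powr p \<partial>lebesgue_on \<Omega>)"
        using L by (simp add: Ip_def powr_mult)
      also have "\<dots> \<le> (\<integral>x. (2 - p) * (L * \<bar>v x\<bar>) + (p - 1) * (L * \<bar>v x\<bar>)\<^sup>2 \<partial>lebesgue_on \<Omega>)"
      \<comment> \<open>This form of monotonicity requires integrability of the nonnegative upper
        function alone, so the power needs no separate argument.\<close>
      proof (rule integral_mono')
        show "integrable (lebesgue_on \<Omega>) (\<lambda>x. (2 - p) * (L * \<bar>v x\<bar>) + (p - 1) * (L * \<bar>v x\<bar>)\<^sup>2)"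
          using int sq_int by (auto simp: power_mult_distrib)
        show "(L * \<bar>v x\<bar>) powr p \<le> (2 - p) * (L * \<bar>v x\<bar>) + (p - 1) * (L * \<bar>v x\<bar>)\<^sup>2" for x
          using L p by (intro powr_le_interpolation) auto
        show "0 \<le> (2 - p) * (L * \<bar>v x\<bar>) + (p - 1) * (L * \<bar>v x\<bar>)\<^sup>2" for x
          using L p by simp
      qed
      also have "\<dots> = (2 - p) * (L * I1) + (p - 1) * (L * (L * I2))"
      proof -
        have "(L * \<bar>v x\<bar>)\<^sup>2 = L * (L * (v x)\<^sup>2)" for x
          by (simp add: power_mult_distrib power2_eq_square)
        then show ?thesis
          using int sq_int by (simp add: I1_def I2_def)
      qed
      also have "\<dots> \<le> (2 - p) * (L * I1) + (p - 1) * (L * I1)"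
        using ray L p by (intro add_mono mult_left_mono) auto
      also have "\<dots> = L * I1"
        by (simp add: algebra_simps)
      finally show ?thesis .
    qed
    then have "(L powr p * Ip / m) powr (1 / p) \<le> (L * I1 / m) powr (1 / p)"
      using m p ge0 by (intro powr_mono2 divide_right_mono) auto
    moreover have "(L powr p * Ip / m) powr (1 / p) = F p \<Omega>"
      using L p ge0 m by (simp add: Fp powr_mult powr_divide powr_powr mult_ac)
    ultimately show ?thesis
      using F1_le L ge0 m by (simp add: F1 mult_ac)
  qed
  then show "F p \<Omega> \<le> F 1 \<Omega> powr (1 / p)" "0 \<le> F 1 \<Omega>" "F 1 \<Omega> \<le> 1"
    by blast+
qed

theorem theorem3:
  fixes p :: real
  assumes "DIM('a::euclidean_space) \<ge> 2"
    and "1 \<le> p" and "p \<le> 2"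
  shows "F_convex TYPE('a) p \<le> (F_convex TYPE('a) 1) powr (1 / p)"
proof -
  define A where "A = {\<Omega> :: 'a set. open \<Omega> \<and> convex \<Omega> \<and>
      0 < emeasure lebesgue \<Omega> \<and> emeasure lebesgue \<Omega> < \<infinity>}"
  have Sup: "F_convex TYPE('a) q = Sup (F q ` A)" for q
    unfolding F_convex_def A_def by (rule arg_cong[of _ _ Sup]) auto
  have A: "F p \<Omega> \<le> F 1 \<Omega> powr (1 / p)" "0 \<le> F 1 \<Omega>" "F 1 \<Omega> \<le> 1" if "\<Omega> \<in> A" for \<Omega>
    using that assms(2,3) bounded_convex_finite_measure
    by (auto simp: A_def intro!: F_interpolation)
  \<comment> \<open>\<open>cSup_least\<close> requires a nonempty set of values.\<close>
  have "ball 0 1 \<in> A"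
    by (auto simp: A_def emeasure_ball)
  then have ne: "A \<noteq> {}"
    by blast
  have bdd: "bdd_above (F 1 ` A)"
    using A(3) by (auto intro!: bdd_aboveI)
  show ?thesis
    unfolding Sup
  proof (rule cSup_least)
    fix y assume "y \<in> F p ` A"
    then obtain \<Omega> where \<Omega>: "\<Omega> \<in> A" "y = F p \<Omega>" by blast
    have "y \<le> F 1 \<Omega> powr (1 / p)"
      using A(1) \<Omega> by simp
    \<comment> \<open>The uniform bound 1 makes the supremum a genuine upper bound, and
      \<open>0 \<le> F 1 \<Omega>\<close> makes the root monotone.\<close>
    also have "\<dots> \<le> Sup (F 1 ` A) powr (1 / p)"
      using \<Omega> A(2) bdd assms(2) by (intro powr_mono2 cSup_upper) auto
    finally show "y \<le> Sup (F 1 ` A) powr (1 / p)" .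
  qed (use ne in simp)
qed

end
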